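(* Let the operators $A$, $\Sigma_0$, the truth $u^\dagger$ and the initial element $\zeta_0$ satisfy Assumption A (in the context), and let $\zeta_n$ be the 3DVAR iterates computed from Data Model 2 with parameter $\alpha$. Then there is a constant $C$, independent of $n$, $\gamma$ and $\alpha$, such that for all $n\ge 1$ $$\mathbb{E}\|\zeta_n-u^\dagger\|^2\le C\left(\frac{\alpha}{n}\right)^{\frac{s}{a+1}}+\frac{n\gamma^2}{\alpha}\,\mathrm{tr}(\Sigma_0).$$ Moreover, for every integer $N\ge 1$, if $\alpha=1$, the noise variance is $\gamma^2=N^{-\frac{a+s+1}{a+1}}$ and the iteration is stopped at $n=N$, then $$\mathbb{E}\|\zeta_N-u^\dagger\|^2\le\left(C+\mathrm{tr}(\Sigma_0)\right)N^{-\frac{s}{a+1}}.$$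
   Context: $X,Y$ are Hilbert spaces, $A$ is a compact linear operator from $X$ to $Y$, $u^\dagger\in X$ is a fixed (deterministic) element, $\gamma>0$, $\alpha>0$. $\|\cdot\|$ denotes the norm of $X$ (also of $Y$ and operator norms), $\mathcal{R}$ and $\mathcal{D}$ denote range and domain. $\mathcal{N}(0,\gamma^2 I)$ is the centred Gaussian on $Y$ with covariance $\gamma^2 I$ (Gaussian white noise if $Y$ is infinite dimensional, so that $\mathbb{E}\|F\eta\|^2=\gamma^2\,\mathrm{tr}(FF^* )$ for $\eta\sim\mathcal{N}(0,\gamma^2I)$ and a bounded linear $F:Y\to X$). Data Model 2: $y_n=y$ for all $n\ge1$, where $y=Au^\dagger+\eta$ with a single draw $\eta\sim\mathcal{N}(0,\gamma^2I)$; the expectation is over $\eta$. 3DVAR: given $\zeta_0\in X$, for $n\ge1$ $$\zeta_n=\zeta_{n-1}+\mathcal{K}(y_n-A\zeta_{n-1}),\qquad \mathcal{K}=\Sigma_0A^*(A\Sigma_0A^*+\alpha I)^{-1}.$$ Assumption A: (i) the filter covariance is $C_0=\frac{\gamma^2}{\alpha}\Sigma_0$ and $\mathcal{R}(\Sigma_0^{1/2})\subset\mathcal{D}(A)$, where $\alpha>0$ is a constant, $\Sigma_0$ is positive self-adjoint on $X$, and $\Sigma_0^{-1}$ is a densely defined unbounded self-adjoint strictly positive operator; (ii) there are constants $a>0$ and $1\le c<\infty$ with $c^{-1}\|\Sigma_0^{a/2}x\|\le\|Ax\|\le c\|\Sigma_0^{a/2}x\|$ for all $x\in X$; (iii) $\zeta_0-u^\dagger\in\mathcal{D}(\Sigma_0^{-s/2})$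 with $0\le s\le a+2$; (iv) $\Sigma_0$ is trace class on $X$. *)

theory Defs
  imports "HOL-Probability.Probability"
begin

text \<open>A (real) Hilbert space is a type of sort real_inner, complete_space; neither
  separability nor infinite dimension is built in.\<close>

section \<open>Operators on Hilbert spaces\<close>

definition compact_operator ::
    "('x::real_normed_vector \<Rightarrow> 'y::real_normed_vector) \<Rightarrow> bool" where
  "compact_operator A \<longleftrightarrow> bounded_linear A \<and> compact (closure (A ` cball 0 1))"

definition positive_self_adjoint :: "('x::real_inner \<Rightarrow> 'x) \<Rightarrow> bool" where
  "positive_self_adjoint S \<longleftrightarrow>
     bounded_linear S \<and> (\<forall>x y. S x \<bullet> y = x \<bullet> S y) \<and> (\<forall>x. 0 \<le> S x \<bullet> x)"

definition orthonormal_basis :: "'x::real_inner set \<Rightarrow> bool" where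
  "orthonormal_basis E \<longleftrightarrow>
     pairwise orthogonal E \<and> (\<forall>e\<in>E. norm e = 1) \<and> closure (span E) = UNIV"

text \<open>Trace class and trace, used for positive self-adjoint operators only. For such an
  operator \<open>\<bar>S\<bar> = S\<close>, and the sum of \<open>S e \<bullet> e\<close> over an orthonormal basis
  does not depend on the basis.\<close>

definition trace_class_pos :: "('x::real_inner \<Rightarrow> 'x) \<Rightarrow> bool" where
  "trace_class_pos S \<longleftrightarrow>
     positive_self_adjoint S \<and> (\<exists>E. orthonormal_basis E \<and> (\<lambda>e. S e \<bullet> e) summable_on E)"

definition trace_pos :: "('x::real_inner \<Rightarrow> 'x) \<Rightarrow> real" where
  "trace_pos S = (\<Sum>\<^sub>\<infinity>e\<in>(SOME E. orthonormal_basis E). S e \<bullet> e)"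

text \<open>Unbounded operators are represented by their graphs, so that the domain is part of
  the operator. ``Unbounded'' means, as usual, ``not necessarily bounded''.\<close>

definition adjoint_graph :: "('x::real_inner \<times> 'x) set \<Rightarrow> ('x \<times> 'x) set" where
  "adjoint_graph T = {(y, z). \<forall>(x, w)\<in>T. w \<bullet> y = x \<bullet> z}"

definition densely_defined_self_adjoint :: "('x::real_inner \<times> 'x) set \<Rightarrow> bool" where
  "densely_defined_self_adjoint T \<longleftrightarrow>
     subspace T \<and> single_valued T \<and> closure (Domain T) = UNIV \<and> adjoint_graph T = T"

definition strictly_positive_graph :: "('x::real_inner \<times> 'x) set \<Rightarrow> bool" where
  "strictly_positive_graph T \<longleftrightarrow> (\<forall>(x, w)\<in>T. x \<noteq> 0 \<longrightarrow> 0 < w \<bullet> x)"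

definition inverse_graph :: "('x \<Rightarrow> 'x) \<Rightarrow> ('x \<times> 'x) set" where
  "inverse_graph S = {(S x, x) | x. True}"

text \<open>Real powers of an injective positive compact (e.g. trace class) operator by the
  functional calculus \<open>S\<^sup>r x = \<Sum> l\<^sup>r P\<^sub>l x\<close>, where \<open>P\<^sub>l\<close> is the orthogonal
  projection onto the eigenspace of the eigenvalue \<open>l > 0\<close>. If \<open>l\<close> is not an
  eigenvalue, the eigenspace is trivial and the term vanishes. For negative \<open>r\<close> the
  operator is defined on a proper subset in general, its domain being
  \<open>{x. \<Sum> l\<^sup>2\<^sup>r \<parallel>P\<^sub>l x\<parallel>\<^sup>2 < \<infinity>}\<close>; for \<open>r \<ge> 0\<close> that set is the whole
  space.\<close>

definition orth_proj :: "'x::real_inner set \<Rightarrow> 'x \<Rightarrow> 'x" where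
  "orth_proj U x = (THE p. p \<in> U \<and> (\<forall>q\<in>U. orthogonal (x - p) q))"

definition eigenspace :: "('x::real_vector \<Rightarrow> 'x) \<Rightarrow> real \<Rightarrow> 'x set" where
  "eigenspace S l = {x. S x = l *\<^sub>R x}"

definition op_powr :: "('x::real_inner \<Rightarrow> 'x) \<Rightarrow> real \<Rightarrow> 'x \<Rightarrow> 'x" where
  "op_powr S r x = (\<Sum>\<^sub>\<infinity>l\<in>{0<..}. (l powr r) *\<^sub>R orth_proj (eigenspace S l) x)"

definition op_powr_dom :: "('x::real_inner \<Rightarrow> 'x) \<Rightarrow> real \<Rightarrow> 'x set" where
  "op_powr_dom S r =
     {x. (\<lambda>l. l powr (2 * r) * (norm (orth_proj (eigenspace S l) x))\<^sup>2) summable_on {0<..}}"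

text \<open>The requirement that the range of \<open>S\<^bsup>1/2\<^esup>\<close> lie in the domain of \<open>A\<close>
  holds automatically, as \<open>A\<close> is a total function. The filter covariance
  \<open>(\<gamma>\<^sup>2/\<alpha>) S\<close> enters only through the gain defined below.\<close>

definition assumption_A ::
    "('x::real_inner \<Rightarrow> 'y::real_normed_vector) \<Rightarrow> ('x \<Rightarrow> 'x) \<Rightarrow> 'x \<Rightarrow> 'x \<Rightarrow> real \<Rightarrow> real \<Rightarrow> real \<Rightarrow> bool"
  where
  "assumption_A A S u z0 a c s \<longleftrightarrow>
     positive_self_adjoint S \<and>
     densely_defined_self_adjoint (inverse_graph S) \<and> strictly_positive_graph (inverse_graph S) \<and>
     0 < a \<and> 1 \<le> c \<and>
     (\<forall>x. inverse c * norm (op_powr S (a/2) x) \<le> norm (A x) \<and>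
          norm (A x) \<le> c * norm (op_powr S (a/2) x)) \<and>
     0 \<le> s \<and> s \<le> a + 2 \<and> z0 - u \<in> op_powr_dom S (- s/2) \<and>
     trace_class_pos S"


section \<open>Gaussian white noise and 3DVAR\<close>

text \<open>In infinite dimensions the law \<open>N(0, \<gamma>\<^sup>2 I)\<close> is not carried by the space \<open>Y\<close>.
  A possibly generalized random element \<open>V\<close> of \<open>Y\<close> is therefore given by the real
  random variables \<open>V h\<close>, to be read as \<open>\<langle>V, h\<rangle>\<close>, for \<open>h\<close> in \<open>Y\<close>.
  A genuine random element \<open>v\<close> corresponds to \<open>V h \<omega> = v \<omega> \<bullet> h\<close>.\<close>

type_synonym ('y, 'w) gen_random = "'y \<Rightarrow> 'w \<Rightarrow> real"

definition white_noise ::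
    "'w measure \<Rightarrow> real \<Rightarrow> ('y::real_inner, 'w) gen_random \<Rightarrow> bool" where
  "white_noise M \<gamma> \<eta> \<longleftrightarrow>
     (\<forall>h. \<eta> h \<in> borel_measurable M) \<and>
     (\<forall>h k a b. AE \<omega> in M. \<eta> (a *\<^sub>R h + b *\<^sub>R k) \<omega> = a * \<eta> h \<omega> + b * \<eta> k \<omega>) \<and>
     (\<forall>h. h \<noteq> 0 \<longrightarrow> distributed M lborel (\<eta> h) (normal_density 0 (\<gamma> * norm h)))"

definition data_model2 ::
    "('x \<Rightarrow> 'y::real_inner) \<Rightarrow> 'x \<Rightarrow> ('y, 'w) gen_random \<Rightarrow> nat \<Rightarrow> ('y, 'w) gen_random" where
  "data_model2 A u \<eta> n h \<omega> = A u \<bullet> h + \<eta> h \<omega>"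

text \<open>\<open>\<xi> = F V\<close> for a genuine random element \<open>\<xi>\<close> and a generalized one \<open>V\<close>.\<close>

definition op_image_of ::
    "'w measure \<Rightarrow> ('y::real_inner \<Rightarrow> 'x::real_inner) \<Rightarrow> ('y, 'w) gen_random \<Rightarrow> ('w \<Rightarrow> 'x) \<Rightarrow> bool"
  where
  "op_image_of M F V \<xi> \<longleftrightarrow>
     \<xi> \<in> borel_measurable M \<and> (\<forall>x. AE \<omega> in M. \<xi> \<omega> \<bullet> x = V (adjoint F x) \<omega>)"

definition gain ::
    "('x::real_inner \<Rightarrow> 'y::real_inner) \<Rightarrow> ('x \<Rightarrow> 'x) \<Rightarrow> real \<Rightarrow> 'y \<Rightarrow> 'x" where
  "gain A S \<alpha> = (\<lambda>y. S (adjoint A (inv (\<lambda>v. A (S (adjoint A v)) + \<alpha> *\<^sub>R v) y)))"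

definition iterates_3dvar ::
    "'w measure \<Rightarrow> ('x::real_inner \<Rightarrow> 'y::real_inner) \<Rightarrow> ('x \<Rightarrow> 'x) \<Rightarrow> real \<Rightarrow> 'x
      \<Rightarrow> (nat \<Rightarrow> ('y, 'w) gen_random) \<Rightarrow> (nat \<Rightarrow> 'w \<Rightarrow> 'x) \<Rightarrow> bool" where
  "iterates_3dvar M A S \<alpha> z0 y \<zeta> \<longleftrightarrow>
     (\<forall>\<omega>. \<zeta> 0 \<omega> = z0) \<and>
     (\<forall>n\<ge>1. \<zeta> n \<in> borel_measurable M \<and>
        (\<exists>\<xi>. op_image_of M (gain A S \<alpha>) (\<lambda>h \<omega>. y n h \<omega> - A (\<zeta> (n - 1) \<omega>) \<bullet> h) \<xi> \<and>
             (\<forall>\<omega>. \<zeta> n \<omega> = \<zeta> (n - 1) \<omega> + \<xi> \<omega>)))"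

end

theory Submission
  imports Defs
begin

text \<open>Write \<open>Q = A S A*\<close>, \<open>R = (Q + \<alpha>)\<^sup>-\<^sup>1\<close>, \<open>D = \<alpha> R\<close> and \<open>G = I - K A = I - S A* R A\<close>. The error satisfies
  \<open>\<zeta>\<^sub>n - u = G\<^sup>n (z\<^sub>0 - u) + F\<^sub>n \<eta>\<close>. From \<open>A G = D A\<close>, \<open>Q R = I - D\<close> and the bound
  \<open>\<langle>(I - D) D\<^sup>k y, y\<rangle> \<le> \<parallel>y\<parallel>\<^sup>2/(k + 1)\<close> (the left side decreases in \<open>k\<close> and telescopes) one obtains by duality
  all smoothing estimates of \<open>G\<^sup>n\<close> between the form of \<open>S\<^sup>-\<^sup>1\<close> and the norm \<open>\<parallel>A x\<parallel>\<close>, as well as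
  \<open>F\<^sub>n F\<^sub>n* \<le> (n/\<alpha>) S\<close>, which bounds the variance by \<open>(n \<gamma>\<^sup>2/\<alpha>) tr S\<close>.

  Assumption A(ii) turns \<open>\<parallel>A x\<parallel>\<close> into \<open>\<parallel>S\<^bsup>a/2\<^esup> x\<parallel>\<close>. Splitting along the spectrum of \<open>S\<close> then replaces the
  Heinz inequality: a dyadic splitting shows that \<open>G\<^sup>n\<close> is bounded in \<open>X\<close> uniformly in \<open>n\<close> and \<open>\<alpha>\<close>, and a
  single splitting of \<open>z\<^sub>0 - u = S\<^bsup>s/2\<^esup> w\<close> at the level \<open>(\<alpha>/n)\<^bsup>1/(a+1)\<^esup>\<close> gives the rate of the bias.\<close>

section \<open>Projections, adjoints and coercive operators on Hilbert spaces\<close>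

text \<open>The obstacle is that \<open>G\<close> is not symmetric in \<open>X\<close>, so
  functional calculus does not bound its powers there. Two other norms behave well:
  \<open>G S = S H\<close> leads to a contraction for the form of \<open>S\<^sup>-\<^sup>1\<close>,
  and \<open>A G = D A\<close> makes the norm of \<open>A x\<close> nonincreasing. In the scale of
  powers of \<open>S\<close> these have exponents -1/2 and a/2, and the norm of \<open>X\<close> has
  exponent 0 in between. The level of the last splitting comes from a balance. On vectors
  \<open>S (Z g)\<close>, where \<open>Z\<close> is the power a/2 of \<open>S\<close>, the form of
  \<open>S\<^sup>-\<^sup>1\<close> decays like \<epsilon> = \<alpha>/n and the squared norm of
  \<open>A x\<close> like \<epsilon>^2; interpolation at level \<mu> yields \<mu> \<epsilon> +
  \<mu>^(-a) \<epsilon>^2, and the two terms agree exactly for \<mu>^(a+1) = \<epsilon>. As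
  \<open>S (Z g)\<close> carries the power (a+2)/2 of \<open>S\<close>, the range s \<le> a + 2 is
  where this argument saturates. Constants in the bias may be lost freely as long as they avoid
  \<alpha> and n, but the variance has to come out with factor one in front of the trace.\<close>

lemma closed_subspace_projection_exists:
  fixes U :: "'a::{real_inner,complete_space} set"
  assumes "subspace U" "closed U"
  obtains p where "p \<in> U" "\<And>q. q \<in> U \<Longrightarrow> (x - p) \<bullet> q = 0"
proof -
  define D where "D = (INF q\<in>U. (norm (x - q))\<^sup>2)"
  have ne: "U \<noteq> {}" using assms(1) subspace_0 by blast
  have bdd: "bdd_below ((\<lambda>q. (norm (x - q))\<^sup>2) ` U)" by (rule bdd_belowI[of _ 0]) auto
  have D_le: "D \<le> (norm (x - q))\<^sup>2" if "q \<in> U" for q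
    unfolding D_def by (rule cINF_lower[OF bdd that])
  have "\<exists>q\<in>U. (norm (x - q))\<^sup>2 < D + 1 / real (Suc n)" for n
    using cINF_less_iff[OF ne bdd, of "D + 1 / real (Suc n)"] by (auto simp: D_def)
  then obtain q where qU: "\<And>n. q n \<in> U" and qD: "\<And>n. (norm (x - q n))\<^sup>2 < D + 1 / real (Suc n)"
    by metis
  have par: "(norm (q n - q m))\<^sup>2 \<le> 2 / real (Suc n) + 2 / real (Suc m)" for n m
  proof -
    \<comment> \<open>The midpoint is no closer to \<open>x\<close> than the infimum, and the
      parallelogram law turns this into a Cauchy estimate for the minimising sequence.\<close>
    have "(1/2) *\<^sub>R (q n + q m) \<in> U"
      using assms(1) qU by (simp add: subspace_add subspace_scale)
    then have "D \<le> (norm (x - (1/2) *\<^sub>R (q n + q m)))\<^sup>2" by (rule D_le)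
    moreover have "(norm (q n - q m))\<^sup>2 =
        2 * (norm (x - q n))\<^sup>2 + 2 * (norm (x - q m))\<^sup>2 - 4 * (norm (x - (1/2) *\<^sub>R (q n + q m)))\<^sup>2"
      by (simp add: power2_norm_eq_inner algebra_simps inner_commute)
    ultimately show ?thesis using qD[of n] qD[of m] by simp
  qed
  have "Cauchy q"
  proof (rule metric_CauchyI)
    fix e :: real assume "0 < e"
    then obtain N where N: "4 / e\<^sup>2 < real N" using reals_Archimedean2 by blast
    have "dist (q m) (q n) < e" if "m \<ge> N" "n \<ge> N" for m n
    proof -
      have pos: "4 / e\<^sup>2 > 0" using \<open>0 < e\<close> by simp
      have half: "2 / real (Suc k) < e\<^sup>2 / 2" if "k \<ge> N" for k
      proof -
        have "4 / e\<^sup>2 < real (Suc k)" using N that by linarith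
        then show ?thesis using \<open>0 < e\<close> by (simp add: field_simps)
      qed
      have "(norm (q m - q n))\<^sup>2 < e\<^sup>2"
        using par[of m n] half[OF that(1)] half[OF that(2)] by linarith
      then show ?thesis using \<open>0 < e\<close> by (simp add: dist_norm power2_less_imp_less)
    qed
    then show "\<exists>M. \<forall>m\<ge>M. \<forall>n\<ge>M. dist (q m) (q n) < e" by blast
  qed
  then obtain p where p: "q \<longlonglongrightarrow> p" using Cauchy_convergent_iff convergent_def by blast
  have pU: "p \<in> U" using closed_sequentially[OF assms(2)] qU p by blast
  have "(norm (x - p))\<^sup>2 \<le> D"
  proof (rule LIMSEQ_le)
    show "(\<lambda>n. (norm (x - q n))\<^sup>2) \<longlonglongrightarrow> (norm (x - p))\<^sup>2" by (intro tendsto_intros p)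
    show "(\<lambda>n. D + 1 / real (Suc n)) \<longlonglongrightarrow> D"
      using tendsto_add[OF tendsto_const[of D] LIMSEQ_inverse_real_of_nat] by (simp add: inverse_eq_divide)
    show "\<exists>N. \<forall>n\<ge>N. (norm (x - q n))\<^sup>2 \<le> D + 1 / real (Suc n)" using qD less_imp_le by blast
  qed
  then have min: "(norm (x - p))\<^sup>2 \<le> (norm (x - r))\<^sup>2" if "r \<in> U" for r
    using D_le[OF that] by linarith
  have "(x - p) \<bullet> v = 0" if "v \<in> U" for v
  proof (cases "v = 0")
    case False
    \<comment> \<open>The best approximation of \<open>x - p\<close> by multiples of
      \<open>v\<close>; minimality of \<open>p\<close> forces it to be 0.\<close>
    define t where "t = ((x - p) \<bullet> v) / (v \<bullet> v)"
    have vv: "0 < v \<bullet> v" using False by simp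
    have "p + t *\<^sub>R v \<in> U" using pU that assms(1) by (simp add: subspace_add subspace_scale)
    from min[OF this] have "(x - p) \<bullet> (x - p) \<le> (x - p - t *\<^sub>R v) \<bullet> (x - p - t *\<^sub>R v)"
      by (simp add: power2_norm_eq_inner diff_diff_eq)
    also have "\<dots> = (x - p) \<bullet> (x - p) - 2 * t * ((x - p) \<bullet> v) + t * t * (v \<bullet> v)"
      by (simp add: inner_diff_left inner_diff_right inner_commute algebra_simps)
    finally have "2 * t * ((x - p) \<bullet> v) \<le> t * t * (v \<bullet> v)" by simp
    moreover have "(x - p) \<bullet> v = t * (v \<bullet> v)" using vv by (simp add: t_def)
    ultimately have "t * t * (v \<bullet> v) \<le> 0" by (simp add: algebra_simps)
    then have "t * t \<le> 0" using vv by (simp add: mult_le_0_iff)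
    then have "t = 0" by (metis mult_eq_0_iff order_antisym zero_le_square)
    then show ?thesis using \<open>(x - p) \<bullet> v = t * (v \<bullet> v)\<close> by simp
  qed simp
  then show ?thesis using that pU by blast
qed

lemma orth_proj_eqI:
  fixes U :: "'a::real_inner set"
  assumes "subspace U" "p \<in> U" "\<And>q. q \<in> U \<Longrightarrow> (x - p) \<bullet> q = 0"
  shows "orth_proj U x = p"
  unfolding orth_proj_def
proof (rule the_equality)
  show "p \<in> U \<and> (\<forall>q\<in>U. orthogonal (x - p) q)" using assms by (simp add: orthogonal_def)
  fix p' assume p': "p' \<in> U \<and> (\<forall>q\<in>U. orthogonal (x - p') q)"
  have d: "p' - p \<in> U" using p' assms by (simp add: subspace_diff)
  have "(x - p) \<bullet> (p' - p) - (x - p') \<bullet> (p' - p) = 0"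
    using p' d assms(3)[OF d] by (simp add: orthogonal_def)
  then have "(p' - p) \<bullet> (p' - p) = 0" by (simp add: inner_diff_left)
  then show "p' = p" by simp
qed

lemma
  fixes U :: "'a::{real_inner,complete_space} set"
  assumes "subspace U" "closed U"
  shows orth_proj_in: "orth_proj U x \<in> U"
    and orth_proj_orthogonal: "q \<in> U \<Longrightarrow> (x - orth_proj U x) \<bullet> q = 0"
proof -
  obtain p where p: "p \<in> U" "\<And>q. q \<in> U \<Longrightarrow> (x - p) \<bullet> q = 0"
    using closed_subspace_projection_exists[OF assms] by blast
  then have "orth_proj U x = p" by (rule orth_proj_eqI[OF assms(1)])
  with p show "orth_proj U x \<in> U" "q \<in> U \<Longrightarrow> (x - orth_proj U x) \<bullet> q = 0" by auto
qed

lemma Riesz_representation: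
  fixes f :: "'a::{real_inner,complete_space} \<Rightarrow> real"
  assumes "bounded_linear f"
  obtains z where "\<And>x. f x = x \<bullet> z"
proof (cases "\<forall>x. f x = 0")
  case True
  then show ?thesis using that[of 0] by simp
next
  case False
  interpret f: bounded_linear f by fact
  define U where "U = {x. f x = 0}"
  have sub: "subspace U" unfolding U_def subspace_def by (simp add: f.zero f.add f.scaleR)
  have "closed U" unfolding U_def
    by (intro closed_Collect_eq continuous_on_const linear_continuous_on assms)
  obtain x0 where x0: "f x0 \<noteq> 0" using False by blast
  obtain p where p: "p \<in> U" "\<And>q. q \<in> U \<Longrightarrow> (x0 - p) \<bullet> q = 0"
    using closed_subspace_projection_exists[OF sub \<open>closed U\<close>] by blast
  define n where "n = x0 - p"
  have fn: "f n \<noteq> 0" using x0 p(1) by (simp add: n_def f.diff U_def)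
  then have nn: "n \<bullet> n \<noteq> 0" using f.zero by auto
  have "f x = x \<bullet> ((f n / (n \<bullet> n)) *\<^sub>R n)" for x
  proof -
    have "x - (f x / f n) *\<^sub>R n \<in> U" using fn by (simp add: U_def f.diff f.scaleR)
    then have "n \<bullet> (x - (f x / f n) *\<^sub>R n) = 0" using p(2) n_def by simp
    then have "n \<bullet> x = (f x / f n) * (n \<bullet> n)" by (simp add: inner_diff_right)
    then show ?thesis using fn nn by (simp add: inner_commute field_simps)
  qed
  then show ?thesis by (rule that)
qed

text \<open>\<open>adjoint\<close> is defined by choice, so its identity is available only once some
  adjoint is known to exist. Riesz supplies one value for each \<open>y\<close>.\<close>

lemma adjoint_inner:
  fixes f :: "'a::{real_inner,complete_space} \<Rightarrow> 'b::real_inner"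
  assumes "bounded_linear f"
  shows "f x \<bullet> y = x \<bullet> adjoint f y"
proof -
  have "\<exists>z. \<forall>x. f x \<bullet> y = x \<bullet> z" for y
  proof -
    have "bounded_linear (\<lambda>x. f x \<bullet> y)"
      using bounded_linear_compose[OF bounded_linear_inner_left assms] by (simp add: o_def)
    from Riesz_representation[OF this] show ?thesis by metis
  qed
  then obtain g where "\<forall>y x. f x \<bullet> y = x \<bullet> g y" by metis
  then have g: "\<forall>x y. f x \<bullet> y = x \<bullet> g y" by blast
  from adjoint_unique[OF this] g show ?thesis by simp
qed

lemma bounded_linear_adjoint:
  fixes f :: "'a::{real_inner,complete_space} \<Rightarrow> 'b::real_inner"
  assumes "bounded_linear f"
  shows "bounded_linear (adjoint f)"
proof -
  note adj = adjoint_inner[OF assms]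
  obtain K where K: "K > 0" "\<And>x. norm (f x) \<le> norm x * K"
    using bounded_linear.pos_bounded[OF assms] by blast
  have "norm (adjoint f y) \<le> norm y * K" for y
  proof -
    have "norm (adjoint f y) * norm (adjoint f y) = f (adjoint f y) \<bullet> y"
      by (simp add: adj power2_norm_eq_inner[symmetric] power2_eq_square[symmetric])
    also have "\<dots> \<le> norm (f (adjoint f y)) * norm y" by (rule norm_cauchy_schwarz)
    also have "\<dots> \<le> (norm (adjoint f y) * K) * norm y" by (intro mult_right_mono K) simp
    finally have "norm (adjoint f y) * norm (adjoint f y) \<le> norm (adjoint f y) * (norm y * K)"
      by (simp add: mult_ac)
    then show ?thesis using K(1) by (cases "adjoint f y = 0") auto
  qed
  moreover have "adjoint f (x + y) = adjoint f x + adjoint f y" for x y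
    by (metis (no_types, lifting) adj inner_add_right vector_eq_ldot)
  moreover have "adjoint f (r *\<^sub>R x) = r *\<^sub>R adjoint f x" for r x
    by (metis (no_types, lifting) adj inner_scaleR_right vector_eq_ldot)
  ultimately show ?thesis by (intro bounded_linear_intro)
qed

text \<open>Surjectivity is the Lax-Milgram argument: for small \<open>t\<close> the map
  \<open>x \<mapsto> x - t (f x - y)\<close> is a contraction.\<close>

lemma bij_coercive:
  fixes f :: "'a::{real_inner,complete_space} \<Rightarrow> 'a"
  assumes f: "bounded_linear f" and "0 < d" and coer: "\<And>x. d * (norm x)\<^sup>2 \<le> f x \<bullet> x"
  shows "bij f"
proof -
  interpret f: bounded_linear f by fact
  have inj: "inj f"
  proof (rule injI)
    fix x y assume "f x = f y"
    then have "d * (norm (x - y))\<^sup>2 \<le> 0" using coer[of "x - y"] by (simp add: f.diff)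
    then have "(norm (x - y))\<^sup>2 \<le> 0" using \<open>0 < d\<close> by (simp add: mult_le_0_iff)
    then show "x = y" by simp
  qed
  obtain K where K: "K > 0" "\<And>x. norm (f x) \<le> norm x * K"
    using f.pos_bounded by blast
  define m where "m = K + d"
  have m: "0 < m" "d < m" and mb: "norm (f x) \<le> m * norm x" for x
    using K(1) \<open>0 < d\<close> K(2)[of x] by (auto simp: m_def algebra_simps intro: order_trans)
  \<comment> \<open>This value minimises \<open>1 - 2 * t * d + t\<^sup>2 * m\<^sup>2\<close>, the
    bound for the squared contraction factor; the minimum is \<open>1 - t * d\<close>. Taking
    \<open>m = K + d\<close> ensures \<open>t * d < 1\<close>.\<close>
  define t where "t = d / m\<^sup>2"
  define q where "q = sqrt (1 - t * d)"
  have "d\<^sup>2 < m\<^sup>2" using m \<open>0 < d\<close> by (simp add: power_strict_mono)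
  then have td: "0 < t" "t * d < 1" "0 < t * d" using m \<open>0 < d\<close>
    by (auto simp: t_def field_simps power2_eq_square)
  have q: "0 \<le> q" "q < 1" "q\<^sup>2 = 1 - t * d" using td by (auto simp: q_def)
  have contr: "norm (x - t *\<^sub>R f x) \<le> q * norm x" for x
  proof (rule power2_le_imp_le)
    have "(norm (x - t *\<^sub>R f x))\<^sup>2 = (norm x)\<^sup>2 - 2 * t * (f x \<bullet> x) + t\<^sup>2 * (norm (f x))\<^sup>2"
      by (simp add: power2_norm_eq_inner inner_diff_left inner_diff_right inner_commute
          algebra_simps power2_eq_square[of t])
    also have "\<dots> \<le> (norm x)\<^sup>2 - 2 * t * (d * (norm x)\<^sup>2) + t\<^sup>2 * (m * norm x)\<^sup>2"
      using td mb[of x] coer[of x] by (intro add_mono diff_mono mult_left_mono power_mono) auto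
    also have "\<dots> = (q * norm x)\<^sup>2"
      using m by (simp add: power_mult_distrib q(3) t_def field_simps power2_eq_square[of m] power2_eq_square[of d])
    finally show "(norm (x - t *\<^sub>R f x))\<^sup>2 \<le> (q * norm x)\<^sup>2" .
  qed (use q in simp)
  have "\<exists>x. f x = y" for y
  proof -
    have "\<exists>!x. x - t *\<^sub>R (f x - y) = x"
    proof (rule banach_fix_type[OF q(1,2)])
      show "\<forall>x x'. dist (x - t *\<^sub>R (f x - y)) (x' - t *\<^sub>R (f x' - y)) \<le> q * dist x x'"
      proof (intro allI)
        fix x x'
        have "(x - t *\<^sub>R (f x - y)) - (x' - t *\<^sub>R (f x' - y)) = (x - x') - t *\<^sub>R f (x - x')"
          by (simp add: f.diff algebra_simps)
        then show "dist (x - t *\<^sub>R (f x - y)) (x' - t *\<^sub>R (f x' - y)) \<le> q * dist x x'"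
          using contr[of "x - x'"] by (simp only: dist_norm)
      qed
    qed
    then show ?thesis using td(1) by auto
  qed
  then have "surj f" by (metis surjI)
  with inj show ?thesis by (simp add: bij_def)
qed

text \<open>The discriminant argument for the form at \<open>t *\<^sub>R x + y\<close>. The form may
  be degenerate, so a vanishing leading coefficient is a case of its own.\<close>

lemma positive_form_Cauchy_Schwarz:
  fixes f :: "'a::real_inner \<Rightarrow> 'a"
  assumes "linear f" and sym: "\<And>x y. f x \<bullet> y = x \<bullet> f y" and pos: "\<And>x. 0 \<le> f x \<bullet> x"
  shows "(f x \<bullet> y)\<^sup>2 \<le> (f x \<bullet> x) * (f y \<bullet> y)"
proof -
  interpret linear f by fact
  have q: "0 \<le> (f x \<bullet> x) * t\<^sup>2 + 2 * (f x \<bullet> y) * t + f y \<bullet> y" for t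
  proof -
    have "0 \<le> f (t *\<^sub>R x + y) \<bullet> (t *\<^sub>R x + y)" by (rule pos)
    also have "\<dots> = (f x \<bullet> x) * t\<^sup>2 + 2 * (f x \<bullet> y) * t + f y \<bullet> y"
      using sym[of y x] by (simp add: add scale inner_add_left inner_add_right inner_commute
        power2_eq_square algebra_simps)
    finally show ?thesis .
  qed
  show ?thesis
  proof (cases "f x \<bullet> x = 0")
    case True
    have "f x \<bullet> y = 0"
    proof (rule ccontr)
      assume n: "f x \<bullet> y \<noteq> 0"
      \<comment> \<open>At this \<open>t\<close> the remaining affine function takes the value
        -1.\<close>
      have "0 \<le> 2 * (f x \<bullet> y) * (- (f y \<bullet> y + 1) / (2 * (f x \<bullet> y))) + f y \<bullet> y"
        using q[of "- (f y \<bullet> y + 1) / (2 * (f x \<bullet> y))"] True by simp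
      then show False using n by (simp add: field_simps)
    qed
    then show ?thesis by (simp add: True)
  next
    case False
    then have p: "0 < f x \<bullet> x" using pos[of x] by simp
    have "0 \<le> (f x \<bullet> x) * (- (f x \<bullet> y) / (f x \<bullet> x))\<^sup>2
        + 2 * (f x \<bullet> y) * (- (f x \<bullet> y) / (f x \<bullet> x)) + f y \<bullet> y"
      by (rule q)
    also have "\<dots> = f y \<bullet> y - (f x \<bullet> y)\<^sup>2 / (f x \<bullet> x)"
      using p by (simp add: field_simps power2_eq_square)
    finally show ?thesis using p by (simp add: field_simps)
  qed
qed

section \<open>Orthogonal expansions\<close>

text \<open>The index set may be uncountable, so the partial sums form a net over finite sets. By
  Pythagoras the squared increment beyond a fixed finite set is a tail of the series of squares;
  completeness gives the limit.\<close>

lemma orthogonal_series_summable: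
  fixes f :: "'i \<Rightarrow> 'a::{real_inner,complete_space}"
  assumes orth: "pairwise (\<lambda>i j. orthogonal (f i) (f j)) A"
    and sq: "(\<lambda>i. (norm (f i))\<^sup>2) summable_on A"
  shows "f summable_on A"
proof -
  let ?g = "\<lambda>i. (norm (f i))\<^sup>2"
  have "\<exists>P. eventually P (finite_subsets_at_top A) \<and>
            (\<forall>F F'. P F \<and> P F' \<longrightarrow> dist (sum f F) (sum f F') < e)" if "0 < e" for e
  proof -
    obtain F0 where F0: "finite F0" "F0 \<subseteq> A" "dist (sum ?g F0) (infsum ?g A) \<le> (e/4)\<^sup>2"
      using has_sum_finite_approximation[OF has_sum_infsum[OF sq], of "(e/4)\<^sup>2"] \<open>0 < e\<close> by auto
    define P where "P F \<longleftrightarrow> finite F \<and> F0 \<subseteq> F \<and> F \<subseteq> A" for F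
    have ev: "eventually P (finite_subsets_at_top A)"
      unfolding eventually_finite_subsets_at_top P_def using F0 by blast
    have near: "dist (sum f F) (sum f F0) < e / 2" if "P F" for F
    proof -
      have F: "finite F" "F0 \<subseteq> F" "F \<subseteq> A" using that by (auto simp: P_def)
      have "(dist (sum f F) (sum f F0))\<^sup>2 = (norm (sum f (F - F0)))\<^sup>2"
        using F by (simp add: dist_norm sum_diff)
      also have "\<dots> = sum ?g (F - F0)"
        by (rule norm_sum_Pythagorean) (use F orth in \<open>auto intro: pairwise_subset\<close>)
      also have "\<dots> = sum ?g F - sum ?g F0" using F by (simp add: sum_diff)
      also have "\<dots> \<le> infsum ?g A - sum ?g F0"
        using finite_sum_le_infsum[OF sq F(1,3)] by simp
      also have "\<dots> \<le> (e/4)\<^sup>2" using F0(3) unfolding dist_real_def by linarith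
      finally have "dist (sum f F) (sum f F0) \<le> e / 4"
        using \<open>0 < e\<close> by (simp add: power2_le_iff_abs_le)
      with \<open>0 < e\<close> show ?thesis by simp
    qed
    have "dist (sum f F) (sum f F') < e" if "P F" "P F'" for F F'
      using near[OF that(1)] near[OF that(2)] dist_triangle2[of "sum f F" "sum f F'" "sum f F0"] by linarith
    with ev show ?thesis by blast
  qed
  then have "cauchy_filter (filtermap (sum f) (finite_subsets_at_top A))"
    by (simp add: cauchy_filter_metric_filtermap)
  moreover have "uniform_space_class.complete (UNIV::'a set)"
    by (rule complete_UNIV_cuspace)
  ultimately obtain L' where "(sum f \<longlongrightarrow> L') (finite_subsets_at_top A)"
    using complete_uniform[where S=UNIV] by (force simp add: filterlim_def)
  then show ?thesis using summable_on_def has_sum_def by blast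
qed

text \<open>Instantiated both with orthonormal bases and with the eigenspaces of a positive trace class operator.\<close>

locale orth_family =
  fixes p :: "'i \<Rightarrow> 'a::{real_inner,complete_space} \<Rightarrow> 'a" and I :: "'i set"
  assumes p_sym: "i \<in> I \<Longrightarrow> p i x \<bullet> y = x \<bullet> p i y"
    and p_idem: "i \<in> I \<Longrightarrow> p i (p i x) = p i x"
    and p_orth: "i \<in> I \<Longrightarrow> j \<in> I \<Longrightarrow> i \<noteq> j \<Longrightarrow> p i x \<bullet> p j y = 0"
    and p_dense: "closure (span (\<Union>i\<in>I. range (p i))) = UNIV"
begin

lemma inner_p: "i \<in> I \<Longrightarrow> x \<bullet> p i x = (norm (p i x))\<^sup>2"
  by (metis p_idem power2_norm_eq_inner p_sym)

text \<open>Symmetry alone forces linearity, and together with idempotence it gives the norm bound 1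
  by Cauchy-Schwarz.\<close>

lemma bounded_linear_p:
  assumes "i \<in> I" shows "bounded_linear (p i)"
proof (rule bounded_linear_intro[where K=1])
  show "p i (x + y) = p i x + p i y" for x y
    by (metis (no_types, lifting) assms inner_add_left p_sym vector_eq_rdot)
  show "p i (r *\<^sub>R x) = r *\<^sub>R p i x" for r x
    by (metis (no_types, lifting) assms inner_scaleR_left p_sym vector_eq_rdot)
  show "norm (p i x) \<le> norm x * 1" for x
  proof -
    have "norm (p i x) * norm (p i x) = x \<bullet> p i x"
      using inner_p[OF assms] by (simp add: power2_eq_square)
    also have "\<dots> \<le> norm x * norm (p i x)" by (rule norm_cauchy_schwarz)
    finally show ?thesis by (cases "p i x = 0") auto
  qed
qed

lemma p_p: "i \<in> I \<Longrightarrow> j \<in> I \<Longrightarrow> i \<noteq> j \<Longrightarrow> p i (p j x) = 0"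
  by (metis inner_eq_zero_iff p_orth p_sym)

lemma p_scaleR: "i \<in> I \<Longrightarrow> p i (r *\<^sub>R x) = r *\<^sub>R p i x"
  using bounded_linear_p linear_simps(5) by blast

lemma p_add: "i \<in> I \<Longrightarrow> p i (x + y) = p i x + p i y"
  using bounded_linear_p linear_simps(1) by blast

lemma p_diff: "i \<in> I \<Longrightarrow> p i (x - y) = p i x - p i y"
  using bounded_linear_p linear_simps(2) by blast

lemma pairwise_p: "F \<subseteq> I \<Longrightarrow> pairwise (\<lambda>i j. orthogonal (\<phi> i *\<^sub>R p i x) (\<phi> j *\<^sub>R p j x)) F"
  by (auto simp: pairwise_def orthogonal_def p_orth subset_iff)

lemma norm_sum_p:
  assumes "finite F" "F \<subseteq> I"
  shows "(norm (\<Sum>i\<in>F. \<phi> i *\<^sub>R p i x))\<^sup>2 = (\<Sum>i\<in>F. (\<phi> i)\<^sup>2 * (norm (p i x))\<^sup>2)"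
  using norm_sum_Pythagorean[OF assms(1) pairwise_p[OF assms(2)]] by (simp add: power_mult_distrib)

lemma norm_diff_sum_p_le:
  assumes F: "finite F" "F \<subseteq> I"
  shows "norm (x - (\<Sum>i\<in>F. p i x)) \<le> norm x"
proof (rule power2_le_imp_le)
  let ?s = "\<Sum>i\<in>F. p i x"
  have s: "?s \<bullet> ?s = (\<Sum>i\<in>F. (norm (p i x))\<^sup>2)"
    using norm_sum_p[OF F, of "\<lambda>_. 1" x] by (simp add: power2_norm_eq_inner)
  have xs: "x \<bullet> ?s = (\<Sum>i\<in>F. (norm (p i x))\<^sup>2)"
    unfolding inner_sum_right by (rule sum.cong) (use F inner_p in auto)
  have "(norm (x - ?s))\<^sup>2 = (norm x)\<^sup>2 - (\<Sum>i\<in>F. (norm (p i x))\<^sup>2)"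
    unfolding power2_norm_eq_inner inner_diff_left inner_diff_right
    using s xs by (simp add: inner_commute power2_norm_eq_inner)
  then show "(norm (x - ?s))\<^sup>2 \<le> (norm x)\<^sup>2" by (simp add: sum_nonneg)
qed simp

text \<open>A vector of the span is reproduced exactly by all sufficiently large finite sums. By
  \<open>norm_diff_sum_p_le\<close> taking the remainder never increases the norm, so convergence
  passes to the closure.\<close>

lemma has_sum_expansion: "((\<lambda>i. p i x) has_sum x) I"
  unfolding has_sum_def tendsto_iff
proof (intro allI impI)
  fix e :: real assume "0 < e"
  have "x \<in> closure (span (\<Union>i\<in>I. range (p i)))" using p_dense by simp
  then obtain y where y: "y \<in> span (\<Union>i\<in>I. range (p i))" "dist y x < e"
    using \<open>0 < e\<close> unfolding closure_approachable by blast
  have "\<exists>F0. finite F0 \<and> F0 \<subseteq> I \<and> (\<forall>F. finite F \<longrightarrow> F0 \<subseteq> F \<longrightarrow> F \<subseteq> I \<longrightarrow> (\<Sum>i\<in>F. p i y) = y)"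
    using y(1)
  proof (induction rule: span_induct_alt)
    case base
    have "p i 0 = 0" if "i \<in> I" for i using p_scaleR[OF that, of 0 0] by simp
    then have "(\<Sum>i\<in>F. p i 0) = 0" if "F \<subseteq> I" for F using that by (intro sum.neutral) auto
    then show ?case by (intro exI[of _ "{}"]) auto
  next
    case (step c z y)
    from step.IH obtain F0 where F0: "finite F0" "F0 \<subseteq> I"
      "\<And>F. finite F \<Longrightarrow> F0 \<subseteq> F \<Longrightarrow> F \<subseteq> I \<Longrightarrow> (\<Sum>i\<in>F. p i y) = y" by metis
    obtain k w where k: "k \<in> I" "z = p k w" using step.hyps by auto
    have "(\<Sum>i\<in>F. p i (c *\<^sub>R z + y)) = c *\<^sub>R z + y"
      if F: "finite F" "insert k F0 \<subseteq> F" "F \<subseteq> I" for F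
    proof -
      have "(\<Sum>i\<in>F. p i (c *\<^sub>R z + y)) = (\<Sum>i\<in>F. c *\<^sub>R p i z + p i y)"
        by (intro sum.cong) (use F p_add p_scaleR in auto)
      also have "\<dots> = c *\<^sub>R (\<Sum>i\<in>F. p i z) + y"
        using F0(3)[of F] F by (simp add: sum.distrib scaleR_sum_right)
      also have "(\<Sum>i\<in>F. p i z) = (\<Sum>i\<in>F. if i = k then z else 0)"
        by (intro sum.cong) (use F k p_idem p_p in auto)
      also have "\<dots> = z" using F by simp
      finally show ?thesis .
    qed
    then show ?case using F0(1,2) k(1)
      by (intro exI[of _ "insert k F0"] conjI allI impI) simp_all
  qed
  then obtain F0 where F0: "finite F0" "F0 \<subseteq> I"
    "\<And>F. finite F \<Longrightarrow> F0 \<subseteq> F \<Longrightarrow> F \<subseteq> I \<Longrightarrow> (\<Sum>i\<in>F. p i y) = y" by metis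
  have "dist (\<Sum>i\<in>F. p i x) x < e" if F: "finite F" "F0 \<subseteq> F" "F \<subseteq> I" for F
  proof -
    have "(\<Sum>i\<in>F. p i (x - y)) = (\<Sum>i\<in>F. p i x - p i y)"
      by (intro sum.cong) (use F p_diff in auto)
    then have "(x - y) - (\<Sum>i\<in>F. p i (x - y)) = x - (\<Sum>i\<in>F. p i x)"
      using F0(3)[OF F] by (simp add: sum_subtractf)
    then have "norm (x - (\<Sum>i\<in>F. p i x)) \<le> norm (x - y)"
      using norm_diff_sum_p_le[OF F(1,3), of "x - y"] by (simp only:)
    then show ?thesis using y(2) by (simp add: dist_norm norm_minus_commute)
  qed
  then show "eventually (\<lambda>F. dist (\<Sum>i\<in>F. p i x) x < e) (finite_subsets_at_top I)"
    unfolding eventually_finite_subsets_at_top using F0(1,2) by blast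
qed

lemma Parseval: "((\<lambda>i. (norm (p i x))\<^sup>2) has_sum (norm x)\<^sup>2) I"
proof -
  have "((\<lambda>i. x \<bullet> p i x) has_sum x \<bullet> x) I"
    by (rule has_sum_bounded_linear[OF bounded_linear_inner_right has_sum_expansion])
  then show ?thesis
    using has_sum_cong[of I "\<lambda>i. x \<bullet> p i x" "\<lambda>i. (norm (p i x))\<^sup>2"] inner_p
    by (simp add: power2_norm_eq_inner)
qed

lemma norm_le_if_coeff_le:
  assumes "\<And>i. i \<in> I \<Longrightarrow> (norm (p i x))\<^sup>2 \<le> c * (norm (p i y))\<^sup>2"
  shows "(norm x)\<^sup>2 \<le> c * (norm y)\<^sup>2"
  using has_sum_mono[OF Parseval has_sum_cmult_right[OF Parseval]] assms by blast

lemma p_has_sum: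
  assumes "((\<lambda>i. \<phi> i *\<^sub>R p i x) has_sum y) I" "k \<in> I"
  shows "p k y = \<phi> k *\<^sub>R p k x"
proof -
  have "((\<lambda>i. p k (\<phi> i *\<^sub>R p i x)) has_sum p k y) I"
    by (rule has_sum_bounded_linear[OF bounded_linear_p[OF assms(2)] assms(1)])
  moreover have "((\<lambda>i. p k (\<phi> i *\<^sub>R p i x)) has_sum \<phi> k *\<^sub>R p k x) I
      \<longleftrightarrow> ((\<lambda>i. \<phi> i *\<^sub>R p i x) has_sum \<phi> k *\<^sub>R p k x) {k}"
    by (rule has_sum_cong_neutral) (use assms(2) p_scaleR p_p p_idem in auto)
  moreover have "((\<lambda>i. \<phi> i *\<^sub>R p i x) has_sum \<phi> k *\<^sub>R p k x) {k}"
    by (rule has_sum_finiteI) auto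
  ultimately show ?thesis using has_sum_unique by blast
qed

text \<open>A spectral multiplier. \<open>infsum\<close> returns 0 for a divergent series, hence the
  summability premise in \<open>p_mult\<close>.\<close>

definition mult :: "('i \<Rightarrow> real) \<Rightarrow> 'a \<Rightarrow> 'a" where
  "mult \<phi> x = (\<Sum>\<^sub>\<infinity>i\<in>I. \<phi> i *\<^sub>R p i x)"

lemma p_mult:
  assumes "(\<lambda>i. (\<phi> i)\<^sup>2 * (norm (p i x))\<^sup>2) summable_on I" "k \<in> I"
  shows "p k (mult \<phi> x) = \<phi> k *\<^sub>R p k x"
proof (rule p_has_sum[OF _ assms(2)])
  have "(\<lambda>i. \<phi> i *\<^sub>R p i x) summable_on I"
    by (rule orthogonal_series_summable[OF pairwise_p])
      (use assms(1) in \<open>simp_all add: power_mult_distrib\<close>)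
  then show "((\<lambda>i. \<phi> i *\<^sub>R p i x) has_sum mult \<phi> x) I" unfolding mult_def by simp
qed

text \<open>The bound is asked only where \<open>p i x\<close> is nonzero. With all positive reals
  as indices a power of \<open>l\<close> is unbounded, but the projections vanish off the
  spectrum.\<close>

lemma p_mult_bounded:
  assumes "\<And>i. i \<in> I \<Longrightarrow> p i x \<noteq> 0 \<Longrightarrow> \<bar>\<phi> i\<bar> \<le> c" "k \<in> I"
  shows "p k (mult \<phi> x) = \<phi> k *\<^sub>R p k x"
proof (rule p_mult[OF _ assms(2)])
  show "(\<lambda>i. (\<phi> i)\<^sup>2 * (norm (p i x))\<^sup>2) summable_on I"
  proof (rule summable_on_comparison_test)
    show "(\<lambda>i. c\<^sup>2 * (norm (p i x))\<^sup>2) summable_on I"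
      using has_sum_cmult_right[OF Parseval] has_sum_imp_summable by blast
    fix i assume "i \<in> I"
    show "(\<phi> i)\<^sup>2 * (norm (p i x))\<^sup>2 \<le> c\<^sup>2 * (norm (p i x))\<^sup>2"
    proof (cases "p i x = 0")
      case False
      then have "(\<phi> i)\<^sup>2 \<le> c\<^sup>2" using assms(1)[OF \<open>i \<in> I\<close>] by (metis abs_ge_zero power2_abs power_mono)
      then show ?thesis by (simp add: mult_right_mono)
    qed simp
  qed simp
qed

end

lemma orthonormal_basis_orth_family:
  fixes E :: "'a::{real_inner,complete_space} set"
  assumes "orthonormal_basis E"
  shows "orth_family (\<lambda>e x. (x \<bullet> e) *\<^sub>R e) E"
proof
  have E: "pairwise orthogonal E" "\<And>e. e \<in> E \<Longrightarrow> e \<bullet> e = 1" "closure (span E) = UNIV"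
    using assms by (auto simp: orthonormal_basis_def norm_eq_1)
  have "E \<subseteq> (\<Union>e\<in>E. range (\<lambda>x. (x \<bullet> e) *\<^sub>R e))"
  proof
    fix e assume "e \<in> E"
    then show "e \<in> (\<Union>e\<in>E. range (\<lambda>x. (x \<bullet> e) *\<^sub>R e))"
      using E(2)[of e] by (intro UN_I[of e] image_eqI[of _ _ e]) auto
  qed
  then have "closure (span E) \<subseteq> closure (span (\<Union>e\<in>E. range (\<lambda>x. (x \<bullet> e) *\<^sub>R e)))"
    by (intro closure_mono span_mono)
  then show "closure (span (\<Union>e\<in>E. range (\<lambda>x. (x \<bullet> e) *\<^sub>R e))) = UNIV" using E(3) by auto
  show "((x \<bullet> i) *\<^sub>R i) \<bullet> ((y \<bullet> j) *\<^sub>R j) = 0" if "i \<in> E" "j \<in> E" "i \<noteq> j" for i j x y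
    using E(1) that by (auto simp: pairwise_def orthogonal_def)
qed (use assms in \<open>auto simp: orthonormal_basis_def norm_eq_1 inner_commute\<close>)

lemma orthonormal_basis_Parseval:
  fixes E :: "'a::{real_inner,complete_space} set"
  assumes "orthonormal_basis E"
  shows "((\<lambda>e. (x \<bullet> e)\<^sup>2) has_sum (norm x)\<^sup>2) E"
proof -
  interpret orth_family "\<lambda>e x. (x \<bullet> e) *\<^sub>R e" E using assms by (rule orthonormal_basis_orth_family)
  have "(norm ((x \<bullet> e) *\<^sub>R e))\<^sup>2 = (x \<bullet> e)\<^sup>2" if "e \<in> E" for e
    using assms that by (simp add: orthonormal_basis_def)
  then show ?thesis using Parseval[of x] has_sum_cong[of E "\<lambda>e. (norm ((x \<bullet> e) *\<^sub>R e))\<^sup>2" "\<lambda>e. (x \<bullet> e)\<^sup>2"]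
    by simp
qed

section \<open>Spectral decomposition of an injective positive trace class operator\<close>

lemma compact_bounded_combinations:
  fixes v :: "'i \<Rightarrow> 'a::real_normed_vector"
  assumes "finite F"
  shows "compact {\<Sum>i\<in>F. t i *\<^sub>R v i | t. \<forall>i\<in>F. \<bar>t i\<bar> \<le> (1::real)}"
  using assms
proof (induction F)
  case empty
  then show ?case by simp
next
  case (insert j F)
  let ?K = "\<lambda>F. {\<Sum>i\<in>F. t i *\<^sub>R v i | t. \<forall>i\<in>F. \<bar>t i\<bar> \<le> (1::real)}"
  have "?K (insert j F) = {x + y | x y. x \<in> (\<lambda>t. t *\<^sub>R v j) ` {-1..1} \<and> y \<in> ?K F}"
  proof (intro equalityI subsetI)
    fix z assume "z \<in> ?K (insert j F)"
    then obtain t where t: "\<And>i. i \<in> insert j F \<Longrightarrow> \<bar>t i\<bar> \<le> 1" "z = (\<Sum>i\<in>insert j F. t i *\<^sub>R v i)"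
      by auto
    have "t j *\<^sub>R v j \<in> (\<lambda>t. t *\<^sub>R v j) ` {-1..1}" using t(1)[of j] by (intro imageI) auto
    moreover have "(\<Sum>i\<in>F. t i *\<^sub>R v i) \<in> ?K F" using t(1) by auto
    moreover have "z = t j *\<^sub>R v j + (\<Sum>i\<in>F. t i *\<^sub>R v i)" using t(2) insert by simp
    ultimately show "z \<in> {x + y | x y. x \<in> (\<lambda>t. t *\<^sub>R v j) ` {-1..1} \<and> y \<in> ?K F}" by blast
  next
    fix z assume "z \<in> {x + y | x y. x \<in> (\<lambda>t. t *\<^sub>R v j) ` {-1..1} \<and> y \<in> ?K F}"
    then obtain s t where st: "s \<in> {-1..1}" "\<And>i. i \<in> F \<Longrightarrow> \<bar>t i\<bar> \<le> 1"
      "z = s *\<^sub>R v j + (\<Sum>i\<in>F. t i *\<^sub>R v i)" by blast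
    have "(\<Sum>i\<in>F. (t(j := s)) i *\<^sub>R v i) = (\<Sum>i\<in>F. t i *\<^sub>R v i)"
      by (rule sum.cong) (use insert in auto)
    then have "z = (\<Sum>i\<in>insert j F. (t(j := s)) i *\<^sub>R v i)" using st(3) insert by simp
    moreover have "\<forall>i\<in>insert j F. \<bar>(t(j := s)) i\<bar> \<le> 1" using st(1,2) by auto
    ultimately show "z \<in> ?K (insert j F)" by blast
  qed
  moreover have "compact ((\<lambda>t. t *\<^sub>R v j) ` {-1..1})"
    by (intro compact_continuous_image continuous_intros) auto
  ultimately show ?case using compact_sums[OF _ insert.IH] by (simp only:)
qed

lemma subspace_closure:
  fixes V :: "'a::real_normed_vector set"
  assumes "subspace V" shows "subspace (closure V)"
  unfolding subspace_def
proof (intro conjI ballI allI)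
  show "0 \<in> closure V" using assms closure_subset subspace_0 by blast
  show "x + y \<in> closure V" if xy: "x \<in> closure V" "y \<in> closure V" for x y
  proof -
    obtain f g where "\<And>n. f n \<in> V" "f \<longlonglongrightarrow> x" "\<And>n. g n \<in> V" "g \<longlonglongrightarrow> y"
      using xy unfolding closure_sequential by blast
    then have "\<forall>n. f n + g n \<in> V" "(\<lambda>n. f n + g n) \<longlonglongrightarrow> x + y"
      using assms by (auto intro: subspace_add tendsto_add)
    then show ?thesis unfolding closure_sequential by (intro exI[of _ "\<lambda>n. f n + g n"]) auto
  qed
  show "c *\<^sub>R x \<in> closure V" if x: "x \<in> closure V" for c x
  proof -
    obtain f where "\<forall>n. f n \<in> V" "f \<longlonglongrightarrow> x"
      using x unfolding closure_sequential by blast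
    then have "\<forall>n. c *\<^sub>R f n \<in> V" "(\<lambda>n. c *\<^sub>R f n) \<longlonglongrightarrow> c *\<^sub>R x"
      using assms by (auto intro: subspace_scale tendsto_scaleR)
    then show ?thesis unfolding closure_sequential by (intro exI[of _ "\<lambda>n. c *\<^sub>R f n"]) auto
  qed
qed

text \<open>Cauchy-Schwarz for the form of \<open>S\<close> at \<open>z\<close> and
  \<open>S z\<close>, followed by cancelling the squared norm of \<open>S z\<close>. The invariant
  set \<open>U\<close> lets \<open>M\<close> be the supremum of the Rayleigh quotient on
  \<open>U\<close> alone.\<close>

lemma positive_self_adjoint_norm_le:
  assumes S: "positive_self_adjoint S" and U: "\<And>z. z \<in> U \<Longrightarrow> S z \<in> U"
    and M: "\<And>z. z \<in> U \<Longrightarrow> S z \<bullet> z \<le> M * (norm z)\<^sup>2" and z: "z \<in> U"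
  shows "(norm (S z))\<^sup>2 \<le> M * (S z \<bullet> z)"
proof (cases "S z = 0")
  case False
  have pos: "0 \<le> S z \<bullet> z" for z using S unfolding positive_self_adjoint_def by blast
  have "(S z \<bullet> S z)\<^sup>2 \<le> (S z \<bullet> z) * (S (S z) \<bullet> S z)"
    by (rule positive_form_Cauchy_Schwarz)
      (use S in \<open>auto simp: positive_self_adjoint_def bounded_linear.linear\<close>)
  also have "\<dots> \<le> (S z \<bullet> z) * (M * (norm (S z))\<^sup>2)"
    by (rule mult_left_mono[OF M[OF U[OF z]] pos])
  finally have "(norm (S z))\<^sup>2 * (norm (S z))\<^sup>2 \<le> (M * (S z \<bullet> z)) * (norm (S z))\<^sup>2"
    unfolding power2_norm_eq_inner power2_eq_square[of "S z \<bullet> S z"] by (simp only: mult_ac)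
  then show ?thesis using False by (simp only: mult_le_cancel_right) simp
next
  case True
  then show ?thesis by simp
qed

section \<open>Compactness of a trace class operator and existence of eigenvectors\<close>

locale injective_trace_class =
  fixes S :: "'a::{real_inner,complete_space} \<Rightarrow> 'a"
  assumes trace_class: "trace_class_pos S" and inj_S: "S x = 0 \<Longrightarrow> x = 0"
begin

lemma psa: "positive_self_adjoint S"
  using trace_class by (simp add: trace_class_pos_def)

lemma bounded_linear_S: "bounded_linear S"
  and sym_S: "S x \<bullet> y = x \<bullet> S y"
  and pos_S: "0 \<le> S x \<bullet> x"
  using psa by (auto simp: positive_self_adjoint_def)

lemmas S_simps = linear_simps[OF bounded_linear_S]

text \<open>The summand 1 keeps \<open>L\<close> positive even on the trivial space, so that it can
  serve as top level of a dyadic grid.\<close>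

definition L :: real where "L = onorm S + 1"

lemma L_pos: "0 < L" and norm_S_le: "norm (S x) \<le> L * norm x"
proof -
  show "0 < L" using onorm_pos_le[OF bounded_linear_S] by (simp add: L_def)
  show "norm (S x) \<le> L * norm x"
    using onorm[OF bounded_linear_S, of x] norm_ge_zero[of x]
    unfolding L_def distrib_right by linarith
qed

lemma S_form_le: "S x \<bullet> x \<le> L * (norm x)\<^sup>2"
proof -
  have "S x \<bullet> x \<le> norm (S x) * norm x" by (rule norm_cauchy_schwarz)
  also have "\<dots> \<le> (L * norm x) * norm x" by (rule mult_right_mono[OF norm_S_le]) simp
  finally show ?thesis by (simp add: power2_eq_square)
qed

lemma norm_S_sq_le: "(norm (S x))\<^sup>2 \<le> L * (S x \<bullet> x)"
  by (rule positive_self_adjoint_norm_le[OF psa, of UNIV]) (simp_all add: S_form_le)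

lemma S_form_pos: "x \<noteq> 0 \<Longrightarrow> 0 < S x \<bullet> x"
  using norm_S_sq_le[of x] inj_S[of x] pos_S[of x] L_pos
  by (metis antisym_conv2 mult_zero_right norm_eq_zero power2_less_eq_zero_iff)

text \<open>By \<open>norm_S_sq_le\<close> the operator is Hilbert-Schmidt: the squared norms of
  \<open>S e\<close> are summable along the basis. Expanding \<open>x\<close> and applying
  Cauchy-Schwarz bounds the tail of \<open>S x\<close> by a tail of these squares, uniformly on the
  unit ball. Coefficients bounded by 1 keep the approximants in a compact set.\<close>

lemma finite_rank_approximation:
  assumes "0 < e"
  shows "\<exists>(F :: 'a set) v. finite F \<and>
    (\<forall>x. norm x \<le> 1 \<longrightarrow> (\<exists>t. (\<forall>i\<in>F. \<bar>t i\<bar> \<le> 1) \<and> norm (S x - (\<Sum>i\<in>F. t i *\<^sub>R v i)) \<le> e))"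
proof -
  obtain E where E: "orthonormal_basis E" and sE: "(\<lambda>e. S e \<bullet> e) summable_on E"
    using trace_class by (auto simp: trace_class_pos_def)
  interpret E: orth_family "\<lambda>e x. (x \<bullet> e) *\<^sub>R e" E by (rule orthonormal_basis_orth_family[OF E])
  have sq: "(\<lambda>e. (norm (S e))\<^sup>2) summable_on E"
    by (rule summable_on_comparison_test[OF summable_on_cmult_right[OF sE, of L]])
      (auto simp: norm_S_sq_le)
  let ?g = "\<lambda>e. (norm (S e))\<^sup>2"
  obtain F where F: "finite F" "F \<subseteq> E" "dist (sum ?g F) (infsum ?g E) \<le> e\<^sup>2"
    using has_sum_finite_approximation[OF has_sum_infsum[OF sq], of "e\<^sup>2"] \<open>0 < e\<close> by auto
  have "\<exists>t. (\<forall>i\<in>F. \<bar>t i\<bar> \<le> 1) \<and> norm (S x - (\<Sum>i\<in>F. t i *\<^sub>R S i)) \<le> e"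
    if x: "norm x \<le> 1" for x
  proof (intro exI[of _ "\<lambda>i. x \<bullet> i"] conjI ballI)
    fix i assume "i \<in> F"
    then have "norm i = 1" using F(2) E by (auto simp: orthonormal_basis_def)
    then show "\<bar>x \<bullet> i\<bar> \<le> 1" using Cauchy_Schwarz_ineq2[of x i] x by simp
  next
    let ?f = "\<lambda>i. (x \<bullet> i) *\<^sub>R S i"
    have "((\<lambda>i. S ((x \<bullet> i) *\<^sub>R i)) has_sum S x) E"
      by (rule has_sum_bounded_linear[OF bounded_linear_S E.has_sum_expansion])
    then have "(sum ?f \<longlongrightarrow> S x) (finite_subsets_at_top E)"
      by (simp add: S_simps has_sum_def)
    then have lim: "((\<lambda>G. norm (sum ?f G - sum ?f F)) \<longlongrightarrow> norm (S x - sum ?f F)) (finite_subsets_at_top E)"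
      by (intro tendsto_intros)
    have bound: "norm (sum ?f G - sum ?f F) \<le> e" if G: "finite G" "F \<subseteq> G" "G \<subseteq> E" for G
    proof -
      have "norm (sum ?f G - sum ?f F) = norm (sum ?f (G - F))"
        using G by (simp add: sum_diff)
      also have "\<dots> \<le> (\<Sum>i\<in>G - F. \<bar>x \<bullet> i\<bar> * \<bar>norm (S i)\<bar>)"
        by (rule order_trans[OF norm_sum]) simp
      also have "\<dots> \<le> L2_set (\<lambda>i. x \<bullet> i) (G - F) * L2_set (\<lambda>i. norm (S i)) (G - F)"
        by (rule L2_set_mult_ineq)
      also have "\<dots> \<le> 1 * e"
      proof (rule mult_mono)
        have "(\<Sum>i\<in>G - F. (x \<bullet> i)\<^sup>2) \<le> (norm x)\<^sup>2"
          using finite_sum_le_has_sum[OF orthonormal_basis_Parseval[OF E], of "G - F" x] G by auto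
        also have "\<dots> \<le> 1" using x by (simp add: power_le_one)
        finally show "L2_set (\<lambda>i. x \<bullet> i) (G - F) \<le> 1" by (simp add: L2_set_def)
        have "sum ?g (G - F) = sum ?g G - sum ?g F" using G by (simp add: sum_diff)
        also have "\<dots> \<le> infsum ?g E - sum ?g F" using finite_sum_le_infsum[OF sq G(1,3)] by simp
        also have "\<dots> \<le> e\<^sup>2" using F(3) unfolding dist_real_def by linarith
        finally show "L2_set (\<lambda>i. norm (S i)) (G - F) \<le> e"
          using \<open>0 < e\<close> by (simp add: L2_set_def real_le_lsqrt sum_nonneg)
      qed (simp_all add: L2_set_def sum_nonneg)
      finally show ?thesis by simp
    qed
    show "norm (S x - (\<Sum>i\<in>F. (x \<bullet> i) *\<^sub>R S i)) \<le> e"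
    proof (rule tendsto_upperbound[OF lim])
      show "\<forall>\<^sub>F G in finite_subsets_at_top E. norm (sum ?f G - sum ?f F) \<le> e"
        unfolding eventually_finite_subsets_at_top using F(1,2) bound by blast
    qed simp
  qed
  with F(1) show ?thesis by (intro exI[of _ F] exI[of _ S] conjI allI impI)
qed

lemma compact_image_unit_ball: "compact (closure (S ` cball 0 1))"
  unfolding compact_eq_totally_bounded
proof (intro conjI allI impI)
  show "uniform_space_class.complete (closure (S ` cball 0 1))" by (simp add: complete_eq_closed)
  fix e :: real assume "0 < e"
  have "0 < e/3" using \<open>0 < e\<close> by simp
  from finite_rank_approximation[OF this] obtain F :: "'a set" and v where F: "finite F"
    "\<forall>x. norm x \<le> 1 \<longrightarrow> (\<exists>t. (\<forall>i\<in>F. \<bar>t i\<bar> \<le> 1) \<and> norm (S x - (\<Sum>i\<in>F. t i *\<^sub>R v i)) \<le> e/3)"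
    by (elim exE conjE)
  let ?K = "{\<Sum>i\<in>F. t i *\<^sub>R v i | t. \<forall>i\<in>F. \<bar>t i\<bar> \<le> (1::real)}"
  have "compact ?K" by (rule compact_bounded_combinations[OF F(1)])
  then have "\<exists>k. finite k \<and> ?K \<subseteq> (\<Union>x\<in>k. ball x (e/3))"
    unfolding compact_eq_totally_bounded using \<open>0 < e\<close> by simp
  then obtain k where k: "finite k" "?K \<subseteq> (\<Union>x\<in>k. ball x (e/3))" by (elim exE conjE)
  have "closure (S ` cball 0 1) \<subseteq> (\<Union>x\<in>k. ball x e)"
  proof
    fix y assume "y \<in> closure (S ` cball 0 1)"
    then have "\<exists>w\<in>S ` cball 0 1. dist w y < e/3"
      using \<open>0 < e\<close> unfolding closure_approachable by (metis divide_pos_pos zero_less_numeral)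
    then obtain x where x: "norm x \<le> 1" "dist (S x) y < e/3" by auto
    obtain t where t: "\<forall>i\<in>F. \<bar>t i\<bar> \<le> 1" "norm (S x - (\<Sum>i\<in>F. t i *\<^sub>R v i)) \<le> e/3"
      using F(2)[rule_format, OF x(1)] by (elim exE conjE)
    have "(\<Sum>i\<in>F. t i *\<^sub>R v i) \<in> ?K" using t(1) by blast
    from subsetD[OF k(2) this]
    obtain z where z: "z \<in> k" "dist z (\<Sum>i\<in>F. t i *\<^sub>R v i) < e/3" by (elim UN_E) simp
    have "dist z y \<le> dist z (\<Sum>i\<in>F. t i *\<^sub>R v i) + (dist (S x) (\<Sum>i\<in>F. t i *\<^sub>R v i) + dist (S x) y)"
      using dist_triangle[of z y "\<Sum>i\<in>F. t i *\<^sub>R v i"] dist_triangle3[of "\<Sum>i\<in>F. t i *\<^sub>R v i" y "S x"]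
      by linarith
    then have "dist z y < e" using z(2) t(2) x(2) by (simp add: dist_norm)
    then show "y \<in> (\<Union>x\<in>k. ball x e)" using z(1) by auto
  qed
  then show "\<exists>k. finite k \<and> closure (S ` cball 0 1) \<subseteq> (\<Union>x\<in>k. ball x e)" using k(1) by blast
qed

text \<open>The supremum of the Rayleigh quotient over the unit sphere of an invariant subspace is
  attained, because \<open>\<parallel>S z - M z\<parallel>\<^sup>2 \<le> M (M - \<langle>S z, z\<rangle>)\<close> for unit vectors.\<close>

lemma invariant_subspace_has_eigenvector:
  assumes U: "subspace U" "closed U" "\<And>z. z \<in> U \<Longrightarrow> S z \<in> U" and "z0 \<in> U" "z0 \<noteq> 0"
  obtains l z where "0 < l" "z \<in> U" "z \<noteq> 0" "S z = l *\<^sub>R z"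
proof -
  define B where "B = {z \<in> U. norm z = 1}"
  define M where "M = (SUP z\<in>B. S z \<bullet> z)"
  have unit: "(1 / norm z) *\<^sub>R z \<in> B" if "z \<in> U" "z \<noteq> 0" for z
    using that U(1) by (simp add: B_def subspace_scale)
  have ne: "B \<noteq> {}" using unit[OF assms(4,5)] by blast
  have bdd: "bdd_above ((\<lambda>z. S z \<bullet> z) ` B)"
  proof (rule bdd_aboveI2)
    show "S z \<bullet> z \<le> L" if "z \<in> B" for z using S_form_le[of z] that by (simp add: B_def)
  qed
  have le_M: "S z \<bullet> z \<le> M" if "z \<in> B" for z
    unfolding M_def by (rule cSUP_upper[OF that bdd])
  obtain b where b: "b \<in> B" using ne by blast
  then have "b \<noteq> 0" by (auto simp: B_def)
  then have "0 < M" using S_form_pos le_M[OF b] by fastforce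
  have form_M: "S z \<bullet> z \<le> M * (norm z)\<^sup>2" if "z \<in> U" for z
  proof (cases "z = 0")
    case False
    have "S ((1 / norm z) *\<^sub>R z) \<bullet> ((1 / norm z) *\<^sub>R z) \<le> M"
      by (rule le_M[OF unit[OF that False]])
    then show ?thesis using False by (simp add: S_simps field_simps power2_eq_square)
  qed (simp add: S_simps)
  have "\<exists>z\<in>B. M - 1 / real (Suc n) < S z \<bullet> z" for n
    using less_cSUP_iff[OF ne bdd, of "M - 1 / real (Suc n)"] by (auto simp: M_def)
  then obtain z where zB: "\<And>n. z n \<in> B" and zM: "\<And>n. M - 1 / real (Suc n) < S (z n) \<bullet> z n"
    by metis
  have zU: "z n \<in> U" and z1: "norm (z n) = 1" for n using zB by (auto simp: B_def)
  have close: "(norm (S (z n) - M *\<^sub>R z n))\<^sup>2 \<le> M * (1 / real (Suc n))" for n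
  proof -
    have "(norm (S (z n) - M *\<^sub>R z n))\<^sup>2 = (norm (S (z n)))\<^sup>2 - 2 * M * (S (z n) \<bullet> z n) + M * M * (norm (z n))\<^sup>2"
      by (simp add: power2_norm_eq_inner inner_diff_left inner_diff_right inner_commute algebra_simps)
    also have "\<dots> \<le> M * (S (z n) \<bullet> z n) - 2 * M * (S (z n) \<bullet> z n) + M * M"
      using positive_self_adjoint_norm_le[OF psa U(3) form_M zU[of n]] z1[of n] by simp
    also have "\<dots> = M * (M - S (z n) \<bullet> z n)" by (simp add: algebra_simps)
    also have "\<dots> \<le> M * (1 / real (Suc n))"
      by (rule mult_left_mono) (use zM[of n] \<open>0 < M\<close> in auto)
    finally show ?thesis .
  qed
  have "S (z n) \<in> closure (S ` cball 0 1)" for n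
    using closure_subset[of "S ` cball 0 1"] z1[of n] by auto
  then obtain y r where r: "strict_mono r" "((\<lambda>n. S (z n)) \<circ> r) \<longlonglongrightarrow> y"
    using compact_image_unit_ball unfolding compact_def by metis
  have "(\<lambda>n. (norm (S (z n) - M *\<^sub>R z n))\<^sup>2) \<longlonglongrightarrow> 0"
  proof (rule tendsto_sandwich[OF _ _ tendsto_const])
    show "(\<lambda>n. M * (1 / real (Suc n))) \<longlonglongrightarrow> 0"
      using tendsto_mult_left[OF LIMSEQ_inverse_real_of_nat, of M] by (simp add: inverse_eq_divide)
  qed (use close in auto)
  then have "(\<lambda>n. norm (S (z n) - M *\<^sub>R z n)) \<longlonglongrightarrow> 0"
    using tendsto_real_sqrt[of "\<lambda>n. (norm (S (z n) - M *\<^sub>R z n))\<^sup>2" 0 sequentially] by simp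
  then have "(\<lambda>n. S (z n) - M *\<^sub>R z n) \<longlonglongrightarrow> 0" by (rule tendsto_norm_zero_cancel)
  \<comment> \<open>Compactness only yields convergence of the images. As \<open>S z - M z\<close>
    tends to 0 along the sequence and \<open>M\<close> is positive, the vectors themselves converge
    too.\<close>
  from LIMSEQ_subseq_LIMSEQ[OF this r(1)]
  have "(\<lambda>n. S (z (r n)) - M *\<^sub>R z (r n)) \<longlonglongrightarrow> 0" by (simp add: o_def)
  from tendsto_diff[OF r(2) this] have "(\<lambda>n. M *\<^sub>R z (r n)) \<longlonglongrightarrow> y" by (simp add: o_def)
  from tendsto_scaleR[OF tendsto_const[of "1/M"] this]
  have lim: "(\<lambda>n. z (r n)) \<longlonglongrightarrow> (1/M) *\<^sub>R y" using \<open>0 < M\<close> by simp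
  define w where "w = (1/M) *\<^sub>R y"
  have "w \<in> U" using closed_sequentially[OF U(2) _ lim] zU by (simp add: w_def)
  have "(\<lambda>n. S (z (r n))) \<longlonglongrightarrow> S w"
    unfolding w_def by (rule bounded_linear.tendsto[OF bounded_linear_S lim])
  then have "S w = y" using r(2) LIMSEQ_unique by (auto simp: o_def)
  then have "S w = M *\<^sub>R w" using \<open>0 < M\<close> by (simp add: w_def)
  moreover have "norm w = 1"
    using tendsto_norm[OF lim] z1 LIMSEQ_unique[OF tendsto_const] by (fastforce simp: w_def)
  ultimately show ?thesis using that[of M w] \<open>0 < M\<close> \<open>w \<in> U\<close> by fastforce
qed

section \<open>Eigenprojections and completeness of the eigenvectors\<close>

lemma eigenspace_closed_subspace: "subspace (eigenspace S l)" "closed (eigenspace S l)"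
proof -
  show "subspace (eigenspace S l)"
    by (auto simp: subspace_def eigenspace_def S_simps algebra_simps)
  show "closed (eigenspace S l)" unfolding eigenspace_def
    by (intro closed_Collect_eq linear_continuous_on bounded_linear_S bounded_linear_scaleR_right)
qed

abbreviation P :: "real \<Rightarrow> 'a \<Rightarrow> 'a" where "P l \<equiv> orth_proj (eigenspace S l)"

lemmas P_in = orth_proj_in[OF eigenspace_closed_subspace]
lemmas P_orthogonal = orth_proj_orthogonal[OF eigenspace_closed_subspace]

lemma P_eigenvector: "S v = l *\<^sub>R v \<Longrightarrow> P l v = v"
  by (rule orth_proj_eqI[OF eigenspace_closed_subspace(1)]) (auto simp: eigenspace_def)

lemma S_P: "S (P l x) = l *\<^sub>R P l x"
  using P_in[of l x] by (simp add: eigenspace_def)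

lemma eigenvectors_orthogonal:
  assumes "S v = l *\<^sub>R v" "S w = m *\<^sub>R w" "l \<noteq> m"
  shows "v \<bullet> w = 0"
  using sym_S[of v w] assms by simp

text \<open>The orthogonal complement \<open>U\<close> of all eigenvectors is closed and invariant.
  Were it nontrivial, it would contain an eigenvector, which would be orthogonal to itself.\<close>

lemma eigenvectors_dense: "closure (span (\<Union>l\<in>{0<..}. range (P l))) = UNIV"
proof (rule ccontr)
  let ?V = "closure (span (\<Union>l\<in>{0<..}. range (P l)))"
  assume "?V \<noteq> UNIV"
  then obtain x where x: "x \<notin> ?V" by blast
  obtain q where q: "q \<in> ?V" "\<And>v. v \<in> ?V \<Longrightarrow> (x - q) \<bullet> v = 0"
    using closed_subspace_projection_exists[OF subspace_closure[OF subspace_span] closed_closure] by metis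
  define U where "U = {z. \<forall>l>0. \<forall>v. S v = l *\<^sub>R v \<longrightarrow> z \<bullet> v = 0}"
  have "x - q \<in> U"
    unfolding U_def
  proof (intro CollectI allI impI)
    fix l :: real and v assume "0 < l" "S v = l *\<^sub>R v"
    then have "v \<in> (\<Union>l\<in>{0<..}. range (P l))"
      using P_eigenvector[of v l] by (intro UN_I[of l] image_eqI[of _ _ v]) auto
    from subsetD[OF closure_subset span_base[OF this]]
    show "(x - q) \<bullet> v = 0" by (rule q(2))
  qed
  moreover have "x - q \<noteq> 0" using x q(1) by auto
  moreover have "subspace U" by (auto simp: U_def subspace_def inner_add_left)
  moreover have "closed U"
    unfolding U_def by (intro closed_Collect_all closed_Collect_imp open_Collect_const
        closed_Collect_eq continuous_on_inner continuous_on_id continuous_on_const)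
  moreover have "S z \<in> U" if "z \<in> U" for z
    using that by (auto simp: U_def sym_S)
  ultimately obtain l z where z: "0 < l" "z \<in> U" "z \<noteq> 0" "S z = l *\<^sub>R z"
    using invariant_subspace_has_eigenvector[of U "x - q"] by blast
  then have "z \<bullet> z = 0" by (auto simp: U_def)
  with z(3) show False by simp
qed

sublocale orth_family P "{0<..}"
proof
  have PP: "P l x \<bullet> y = P l x \<bullet> P l y" for l x y
    using P_orthogonal[OF P_in[of l x], of y] by (simp add: inner_diff_left inner_diff_right inner_commute)
  show "P l x \<bullet> y = x \<bullet> P l y" for l x y
    using PP[of l x y] PP[of l y x] by (simp add: inner_commute)
  show "P l (P l x) = P l x" for l x by (rule P_eigenvector[OF S_P])
  show "P l x \<bullet> P m y = 0" if "l \<noteq> m" for l m x y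
    by (rule eigenvectors_orthogonal[OF S_P S_P that])
qed (rule eigenvectors_dense)

lemma P_S: "0 < l \<Longrightarrow> P l (S x) = l *\<^sub>R P l x"
proof -
  assume "0 < l"
  have "P l (S x) \<bullet> y = (l *\<^sub>R P l x) \<bullet> y" for y
    using \<open>0 < l\<close> p_sym[of l "S x" y] p_sym[of l x y] sym_S[of x "P l y"] by (simp add: S_P)
  then show ?thesis using vector_eq_rdot by blast
qed

lemma S_form_has_sum: "((\<lambda>l. l * (norm (P l x))\<^sup>2) has_sum S x \<bullet> x) {0<..}"
proof -
  have "((\<lambda>l. S x \<bullet> P l x) has_sum S x \<bullet> x) {0<..}"
    by (rule has_sum_bounded_linear[OF bounded_linear_inner_right has_sum_expansion])
  moreover have "S x \<bullet> P l x = l * (norm (P l x))\<^sup>2" if "l \<in> {0<..}" for l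
    using inner_p[OF that, of x] by (simp add: sym_S S_P)
  ultimately show ?thesis
    using has_sum_cong[of "{0<..}" "\<lambda>l. S x \<bullet> P l x" "\<lambda>l. l * (norm (P l x))\<^sup>2"] by simp
qed

lemma eigenvalue_le: "0 < l \<Longrightarrow> P l x \<noteq> 0 \<Longrightarrow> l \<le> L"
  using norm_S_le[of "P l x"] by (simp add: S_P)

section \<open>Fractional powers, and the trace in different bases\<close>

lemma op_powr_eq_mult: "op_powr S r = mult (\<lambda>l. l powr r)"
  by (rule ext) (simp add: op_powr_def mult_def)

lemma P_op_powr:
  assumes "0 \<le> r" "0 < l" shows "P l (op_powr S r x) = l powr r *\<^sub>R P l x"
  unfolding op_powr_eq_mult
  by (rule p_mult_bounded[where c="L powr r"]) (use assms eigenvalue_le in \<open>auto intro: powr_mono2\<close>)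

lemma norm_op_powr_has_sum:
  assumes "0 \<le> r"
  shows "((\<lambda>l. l powr (2 * r) * (norm (P l x))\<^sup>2) has_sum (norm (op_powr S r x))\<^sup>2) {0<..}"
proof -
  have "(norm (P l (op_powr S r x)))\<^sup>2 = l powr (2 * r) * (norm (P l x))\<^sup>2" if "l \<in> {0<..}" for l
  proof -
    have "(l powr r)\<^sup>2 = l powr (2 * r)" by (simp add: power2_eq_square flip: powr_add)
    then show ?thesis using that assms by (simp add: P_op_powr power_mult_distrib)
  qed
  then show ?thesis
    using Parseval[of "op_powr S r x"] has_sum_cong[of "{0<..}" "\<lambda>l. (norm (P l (op_powr S r x)))\<^sup>2"
        "\<lambda>l. l powr (2 * r) * (norm (P l x))\<^sup>2"] by simp
qed

lemma op_powr_sym: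
  assumes "0 \<le> r" shows "op_powr S r x \<bullet> y = x \<bullet> op_powr S r y"
proof -
  have "((\<lambda>l. P l (op_powr S r x) \<bullet> y) has_sum op_powr S r x \<bullet> y) {0<..}"
    by (rule has_sum_bounded_linear[OF bounded_linear_inner_left has_sum_expansion])
  moreover have "((\<lambda>l. x \<bullet> P l (op_powr S r y)) has_sum x \<bullet> op_powr S r y) {0<..}"
    by (rule has_sum_bounded_linear[OF bounded_linear_inner_right has_sum_expansion])
  moreover have "P l (op_powr S r x) \<bullet> y = x \<bullet> P l (op_powr S r y)" if "l \<in> {0<..}" for l
    using that assms p_sym[of l x y] by (simp add: P_op_powr)
  ultimately show ?thesis
    using has_sum_cong[of "{0<..}" "\<lambda>l. P l (op_powr S r x) \<bullet> y" "\<lambda>l. x \<bullet> P l (op_powr S r y)"]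
      has_sum_unique by metis
qed

lemma norm_sqrt_S: "(norm (op_powr S (1/2) x))\<^sup>2 = S x \<bullet> x"
proof -
  have "((\<lambda>l. l * (norm (P l x))\<^sup>2) has_sum (norm (op_powr S (1/2) x))\<^sup>2) {0<..}"
    using norm_op_powr_has_sum[of "1/2" x]
      has_sum_cong[of "{0<..}" "\<lambda>l. l powr (2 * (1/2)) * (norm (P l x))\<^sup>2" "\<lambda>l. l * (norm (P l x))\<^sup>2"]
    by simp
  then show ?thesis using S_form_has_sum has_sum_unique by blast
qed

text \<open>\<open>trace_pos\<close> sums over a basis picked by choice, while the trace class
  assumption speaks of some other basis \<open>E'\<close>. With the square root \<open>?T\<close>,
  Parseval in \<open>E'\<close> and Bessel in \<open>E\<close> bound every finite sum over
  \<open>E\<close> by the trace computed in \<open>E'\<close>.\<close>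

lemma trace_summable:
  assumes E: "orthonormal_basis E"
  shows "(\<lambda>e. S e \<bullet> e) summable_on E"
proof (rule nonneg_bdd_above_summable_on)
  obtain E' where E': "orthonormal_basis E'" and sE': "(\<lambda>e. S e \<bullet> e) summable_on E'"
    using trace_class by (auto simp: trace_class_pos_def)
  let ?T = "op_powr S (1/2)"
  show "bdd_above (sum (\<lambda>e. S e \<bullet> e) ` {F. F \<subseteq> E \<and> finite F})"
  proof (rule bdd_aboveI2)
    fix F assume "F \<in> {F. F \<subseteq> E \<and> finite F}"
    then have F: "F \<subseteq> E" "finite F" by auto
    have "((\<lambda>e'. \<Sum>e\<in>F. (?T e \<bullet> e')\<^sup>2) has_sum (\<Sum>e\<in>F. (norm (?T e))\<^sup>2)) E'"
      using F(2)
      by (induction F) (auto intro!: has_sum_add orthonormal_basis_Parseval[OF E'])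
    moreover have "(\<Sum>e'\<in>F'. \<Sum>e\<in>F. (?T e \<bullet> e')\<^sup>2) \<le> (\<Sum>\<^sub>\<infinity>e\<in>E'. S e \<bullet> e)"
      if F': "finite F'" "F' \<subseteq> E'" for F'
    proof -
      have "(\<Sum>e\<in>F. (?T e \<bullet> e')\<^sup>2) \<le> S e' \<bullet> e'" for e'
      proof -
        have "?T e \<bullet> e' = ?T e' \<bullet> e" for e
          using op_powr_sym[of "1/2" e e'] by (simp add: inner_commute)
        then show ?thesis
          using finite_sum_le_has_sum[OF orthonormal_basis_Parseval[OF E] F(2,1), of "?T e'"]
          by (simp add: norm_sqrt_S)
      qed
      then have "(\<Sum>e'\<in>F'. \<Sum>e\<in>F. (?T e \<bullet> e')\<^sup>2) \<le> (\<Sum>e'\<in>F'. S e' \<bullet> e')" by (rule sum_mono)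
      also have "\<dots> \<le> (\<Sum>\<^sub>\<infinity>e\<in>E'. S e \<bullet> e)" by (rule finite_sum_le_infsum[OF sE' F']) (simp add: pos_S)
      finally show ?thesis .
    qed
    ultimately have "(\<Sum>e\<in>F. (norm (?T e))\<^sup>2) \<le> (\<Sum>\<^sub>\<infinity>e\<in>E'. S e \<bullet> e)" by (rule has_sum_le_finite_sums)
    then show "(\<Sum>e\<in>F. S e \<bullet> e) \<le> (\<Sum>\<^sub>\<infinity>e\<in>E'. S e \<bullet> e)" by (simp add: norm_sqrt_S)
  qed
qed (simp add: pos_S)

text \<open>A summable family of strictly positive terms is countable, so an injective trace class
  operator forces separability. Countability is what makes Fatou's lemma applicable later.\<close>

lemma countable_orthonormal_basis:
  fixes E :: "'a set"
  assumes E: "orthonormal_basis E" shows "countable E"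
proof -
  have "S e \<bullet> e \<noteq> 0" if "e \<in> E" for e
    using that E S_form_pos[of e] by (fastforce simp: orthonormal_basis_def)
  then have "E = {e \<in> E. S e \<bullet> e \<noteq> 0}" by blast
  then show ?thesis using summable_countable_real[OF trace_summable[OF E]] by simp
qed

end

section \<open>Resolvent estimates for the gain\<close>

text \<open>The closing step of the duality arguments: testing a quantity against itself reproduces
  it as a factor on the right.\<close>

lemma le_if_mult_self_le:
  fixes x b :: real
  assumes "x * x \<le> b * x" "0 \<le> x" "0 \<le> b" shows "x \<le> b"
proof (cases "x = 0")
  case False
  then have "0 < x" using assms(2) by simp
  with assms(1) show ?thesis by (rule mult_right_le_imp_le)
qed (use assms in simp)

locale tikhonov_gain = injective_trace_class S
  for S :: "'x::{real_inner,complete_space} \<Rightarrow> 'x" +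
  fixes A :: "'x \<Rightarrow> 'y::{real_inner,complete_space}" and \<alpha> :: real
  assumes bounded_linear_A: "bounded_linear A" and \<alpha>_pos: "0 < \<alpha>"
begin

lemmas A_simps = linear_simps[OF bounded_linear_A]

abbreviation At :: "'y \<Rightarrow> 'x" where "At \<equiv> adjoint A"

lemmas inner_A = adjoint_inner[OF bounded_linear_A]
lemmas bounded_linear_At = bounded_linear_adjoint[OF bounded_linear_A]
lemmas At_simps = linear_simps[OF bounded_linear_At]

definition Q :: "'y \<Rightarrow> 'y" where "Q v = A (S (At v))"
definition R :: "'y \<Rightarrow> 'y" where "R = inv (\<lambda>v. Q v + \<alpha> *\<^sub>R v)"
definition D :: "'y \<Rightarrow> 'y" where "D y = \<alpha> *\<^sub>R R y"

lemma bounded_linear_Q: "bounded_linear Q"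
  using bounded_linear_compose[OF bounded_linear_A bounded_linear_compose[OF bounded_linear_S bounded_linear_At]]
  by (simp add: Q_def[abs_def])

lemmas Q_simps = linear_simps[OF bounded_linear_Q]

lemma Q_form: "Q x \<bullet> y = S (At x) \<bullet> At y"
  by (simp add: Q_def inner_A)

lemma Q_sym: "Q x \<bullet> y = x \<bullet> Q y"
  using sym_S[of "At x" "At y"] Q_form[of x y] Q_form[of y x] inner_commute[of x "Q y"]
    inner_commute[of "At x" "S (At y)"] by simp

text \<open>\<open>Q\<close> is positive, so \<open>Q + \<alpha>\<close> is coercive with constant
  \<alpha> and hence bijective; this makes \<open>R\<close>, an \<open>inv\<close>, a two-sided
  inverse.\<close>

lemma Q_R: "Q (R y) + \<alpha> *\<^sub>R R y = y" and R_cancel: "R (Q v + \<alpha> *\<^sub>R v) = v"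
proof -
  let ?f = "\<lambda>v. Q v + \<alpha> *\<^sub>R v"
  have "\<alpha> * (norm v)\<^sup>2 \<le> ?f v \<bullet> v" for v
    using pos_S[of "At v"] by (simp add: inner_add_left Q_form power2_norm_eq_inner)
  then have bij: "bij ?f"
    using bij_coercive[of ?f \<alpha>] \<alpha>_pos bounded_linear_add[OF bounded_linear_Q bounded_linear_scaleR_right]
    by simp
  show "?f (R y) = y" unfolding R_def by (rule surj_f_inv_f[OF bij_is_surj[OF bij]])
  show "R (?f v) = v" unfolding R_def by (rule inv_f_f[OF bij_is_inj[OF bij]])
qed

lemma Q_R': "Q (R y) = y - D y"
  using Q_R[of y] by (simp add: D_def algebra_simps)

lemma R_add: "R (x + y) = R x + R y"
proof -
  have "R x + R y = R (Q (R x + R y) + \<alpha> *\<^sub>R (R x + R y))" by (simp only: R_cancel)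
  also have "Q (R x + R y) + \<alpha> *\<^sub>R (R x + R y) = x + y" by (simp add: Q_simps Q_R' D_def algebra_simps)
  finally show ?thesis ..
qed

lemma R_scaleR: "R (c *\<^sub>R x) = c *\<^sub>R R x"
proof -
  have "c *\<^sub>R R x = R (Q (c *\<^sub>R R x) + \<alpha> *\<^sub>R (c *\<^sub>R R x))" by (simp only: R_cancel)
  also have "Q (c *\<^sub>R R x) + \<alpha> *\<^sub>R (c *\<^sub>R R x) = c *\<^sub>R x" by (simp add: Q_simps Q_R' D_def algebra_simps)
  finally show ?thesis ..
qed

lemma R_sym: "R x \<bullet> y = x \<bullet> R y"
proof -
  have "R x \<bullet> y = R x \<bullet> (Q (R y) + \<alpha> *\<^sub>R R y)" by (simp only: Q_R)
  also have "\<dots> = (Q (R x) + \<alpha> *\<^sub>R R x) \<bullet> R y" by (simp add: inner_add_left inner_add_right Q_sym)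
  finally show ?thesis by (simp only: Q_R)
qed

lemma D_sym: "D x \<bullet> y = x \<bullet> D y"
  by (simp add: D_def R_sym)

text \<open>Inserting \<open>y = Q (R y) + \<alpha> *\<^sub>R R y\<close> into the form leaves the
  squared norm of \<open>D y\<close> plus a nonnegative form of \<open>Q\<close>. As operators,
  \<open>D\<^sup>2 \<le> D\<close>.\<close>

lemma D_form_ge: "(norm (D y))\<^sup>2 \<le> D y \<bullet> y"
proof -
  have "D y \<bullet> y = \<alpha> * (R y \<bullet> (Q (R y) + \<alpha> *\<^sub>R R y))" by (simp only: Q_R) (simp add: D_def)
  also have "\<dots> = \<alpha> * (Q (R y) \<bullet> R y) + D y \<bullet> D y"
    by (simp add: D_def inner_add_right inner_commute distrib_left)
  finally show ?thesis using \<alpha>_pos pos_S by (simp add: Q_form power2_norm_eq_inner)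
qed

lemma norm_D_le: "norm (D y) \<le> norm y"
proof -
  have "norm (D y) * norm (D y) \<le> norm (D y) * norm y"
    using D_form_ge[of y] norm_cauchy_schwarz[of "D y" y] by (simp add: power2_eq_square)
  then show ?thesis by (cases "D y = 0") auto
qed

lemma bounded_linear_D: "bounded_linear D"
  by (rule bounded_linear_intro[where K=1])
    (use norm_D_le in \<open>simp_all add: D_def R_add R_scaleR scaleR_add_right\<close>)

lemma bounded_linear_D_pow: "bounded_linear (D ^^ k)"
  by (induction k) (simp_all add: bounded_linear_ident[folded id_def] bounded_linear_compose[OF bounded_linear_D] o_def)

lemmas D_pow_simps = linear_simps[OF bounded_linear_D_pow]

lemma norm_D_pow_le: "norm ((D ^^ k) y) \<le> norm y"
  by (induction k) (auto intro: order_trans norm_D_le)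

lemma D_pow_sym: "(D ^^ k) x \<bullet> y = x \<bullet> (D ^^ k) y"
  by (induction k arbitrary: x y) (simp_all add: D_sym funpow_swap1)

lemma D_pow_add_form: "(D ^^ (k + m)) x \<bullet> y = (D ^^ k) x \<bullet> (D ^^ m) y"
proof -
  have "(D ^^ (k + m)) x = (D ^^ m) ((D ^^ k) x)" by (subst add.commute) (simp add: funpow_add)
  then show ?thesis by (simp add: D_pow_sym)
qed

section \<open>Decay of the quadratic forms of \<open>D\<^sup>k\<close> and
  \<open>(I - D) D\<^sup>k\<close>\<close>

definition q :: "nat \<Rightarrow> 'y \<Rightarrow> real" where "q k y = (D ^^ k) y \<bullet> y"
definition d :: "nat \<Rightarrow> 'y \<Rightarrow> real" where "d k y = q k y - q (Suc k) y"

lemma q_even: "q (m + m) y = (norm ((D ^^ m) y))\<^sup>2"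
  by (simp add: q_def D_pow_add_form power2_norm_eq_inner)

lemma q_odd: "q (Suc (m + m)) y = D ((D ^^ m) y) \<bullet> (D ^^ m) y"
  using D_pow_add_form[of "Suc m" m y y] by (simp add: q_def)

lemma even_or_odd_double:
  fixes k :: nat
  obtains m where "k = m + m" | m where "k = Suc (m + m)"
  by (cases "even k") (auto elim!: evenE oddE simp: mult_2)

text \<open>Symmetry distributes the power over both arguments: an even power becomes a square, an
  odd one leaves a single \<open>D\<close> in the middle. The parity split thus does the work of a
  square root of \<open>D\<close>.\<close>

lemma q_nonneg: "0 \<le> q k y"
proof (rule even_or_odd_double[of k])
  show "0 \<le> q k y" if "k = Suc (m + m)" for m
    unfolding that q_odd by (rule order_trans[OF zero_le_power2 D_form_ge])
qed (simp add: q_even)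

lemma d_nonneg: "0 \<le> d k y"
proof (rule even_or_odd_double[of k])
  show "0 \<le> d k y" if "k = m + m" for m
  proof -
    let ?z = "(D ^^ m) y"
    have "D ?z \<bullet> ?z \<le> norm (D ?z) * norm ?z" by (rule norm_cauchy_schwarz)
    also have "\<dots> \<le> norm ?z * norm ?z" by (intro mult_right_mono norm_D_le) simp
    finally show ?thesis using that by (simp add: d_def q_even q_odd power2_eq_square)
  qed
  show "0 \<le> d k y" if "k = Suc (m + m)" for m
    using D_form_ge[of "(D ^^ m) y"] q_even[of "Suc m" y] that by (simp add: d_def q_odd)
qed

text \<open>The difference is the form of \<open>D\<^sup>k\<close> at
  \<open>(I - D) y\<close>.\<close>

lemma d_antimono: "d (Suc k) y \<le> d k y"
proof -
  define z where "z = (D ^^ k) y"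
  have "(D ^^ k) (y - D y) = z - D z" by (simp add: z_def D_pow_simps funpow_swap1)
  then have "q k (y - D y) = z \<bullet> y - z \<bullet> D y - (D z \<bullet> y - D z \<bullet> D y)"
    by (simp only: q_def inner_diff_left inner_diff_right)
  also have "\<dots> = z \<bullet> y - D z \<bullet> y - (D z \<bullet> y - D (D z) \<bullet> y)"
    by (simp only: D_sym[symmetric])
  also have "\<dots> = d k y - d (Suc k) y" by (simp add: d_def q_def z_def)
  finally have "d k y - d (Suc k) y = q k (y - D y)" ..
  then show ?thesis using q_nonneg[of k "y - D y"] by linarith
qed

lemma d_le: "d n y \<le> (norm y)\<^sup>2 / real (Suc n)"
proof -
  have mono: "d n y \<le> d k y" if "k \<le> n" for k
    using lift_Suc_antimono_le[of "\<lambda>k. d k y", OF d_antimono that] .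
  have "real (Suc n) * d n y = (\<Sum>k<Suc n. d n y)" by simp
  also have "\<dots> \<le> (\<Sum>k<Suc n. d k y)" by (intro sum_mono mono) auto
  also have "\<dots> = q 0 y - q (Suc n) y" unfolding d_def by (rule sum_lessThan_telescope')
  also have "\<dots> \<le> (norm y)\<^sup>2" using q_nonneg[of "Suc n" y] by (simp add: q_def power2_norm_eq_inner)
  finally show ?thesis by (simp add: field_simps)
qed

lemma Q_D_pow: "Q ((D ^^ Suc m) y) = \<alpha> *\<^sub>R ((D ^^ m) y - (D ^^ Suc m) y)"
proof -
  have "Q (D z) = \<alpha> *\<^sub>R (z - D z)" for z
    unfolding D_def[of z] Q_simps Q_R' by (simp add: D_def)
  then show ?thesis by simp
qed

text \<open>Since \<open>Q D = \<alpha> (I - D)\<close>, with n = m + 1 the form is \<alpha> times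
  that of \<open>(I - D) D\<^sup>k\<close> for k = 2m + 1. \<open>d_le\<close> even gives the
  denominator 2n, of which n is kept.\<close>

lemma Q_D_pow_form: "0 < n \<Longrightarrow> Q ((D ^^ n) y) \<bullet> (D ^^ n) y \<le> \<alpha> / real n * (norm y)\<^sup>2"
proof -
  assume "0 < n"
  then obtain m where n: "n = Suc m" by (cases n) auto
  have "(D ^^ m) y \<bullet> (D ^^ Suc m) y = q (Suc (m + m)) y"
    "(D ^^ Suc m) y \<bullet> (D ^^ Suc m) y = q (Suc (Suc (m + m))) y"
    by (simp_all only: q_def D_pow_add_form[symmetric] add_Suc add_Suc_right)
  then have "Q ((D ^^ n) y) \<bullet> (D ^^ n) y = \<alpha> * d (Suc (m + m)) y"
    by (simp only: n Q_D_pow inner_scaleR_left inner_diff_left d_def)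
  also have "\<dots> \<le> \<alpha> * ((norm y)\<^sup>2 / real (Suc (Suc (m + m))))"
    by (rule mult_left_mono[OF d_le]) (use \<alpha>_pos in simp)
  also have "\<dots> \<le> \<alpha> * ((norm y)\<^sup>2 / real n)"
    by (intro mult_left_mono divide_left_mono) (use \<alpha>_pos n in auto)
  finally show ?thesis by simp
qed

text \<open>For a positive self-adjoint operator a bound on the form is a bound on the norm; here
  the operator is \<open>?T\<close>, that is \<open>(I - D) D\<^sup>m\<close> with m = n -
  1.\<close>

lemma norm_Q_D_pow: "0 < n \<Longrightarrow> norm (Q ((D ^^ n) y)) \<le> \<alpha> / real n * norm y"
proof -
  assume "0 < n"
  then obtain m where n: "n = Suc m" by (cases n) auto
  let ?T = "\<lambda>y. (D ^^ m) y - (D ^^ Suc m) y"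
  have form: "?T z \<bullet> z = d m z" for z
    by (simp only: inner_diff_left d_def q_def)
  have "positive_self_adjoint ?T"
    unfolding positive_self_adjoint_def form
    by (intro conjI allI bounded_linear_sub bounded_linear_D_pow d_nonneg)
      (simp only: inner_diff_left inner_diff_right D_pow_sym)
  then have "(norm (?T y))\<^sup>2 \<le> 1 / real n * (?T y \<bullet> y)"
    by (rule positive_self_adjoint_norm_le[of _ UNIV]) (use d_le[of m] n in \<open>simp_all only: form, auto\<close>)
  also have "\<dots> \<le> 1 / real n * (1 / real n * (norm y)\<^sup>2)"
    using d_le[of m y] n by (intro mult_left_mono) (simp_all only: form, auto)
  also have "\<dots> = (1 / real n * norm y)\<^sup>2" by (simp add: power2_eq_square)
  finally have "norm (?T y) \<le> 1 / real n * norm y" by (rule power2_le_imp_le) simp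
  then have "\<alpha> * norm (?T y) \<le> \<alpha> * (1 / real n * norm y)"
    by (rule mult_left_mono) (use \<alpha>_pos in simp)
  then show ?thesis unfolding n Q_D_pow using \<alpha>_pos by simp
qed

text \<open>\<open>G\<close> is the error propagator \<open>I - K A\<close>, and \<open>H\<close> is its adjoint.\<close>

definition G :: "'x \<Rightarrow> 'x" where "G x = x - S (At (R (A x)))"
definition H :: "'x \<Rightarrow> 'x" where "H x = x - At (R (A (S x)))"

lemma gain_eq: "gain A S \<alpha> = (\<lambda>y. S (At (R y)))"
  by (simp add: gain_def R_def Q_def)

lemma inner_S_At: "S (At r) \<bullet> y = r \<bullet> A (S y)"
  using inner_A[of "S y" r] by (simp add: sym_S inner_commute)

lemma adjoint_gain: "adjoint (gain A S \<alpha>) = (\<lambda>x. R (A (S x)))"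
  unfolding gain_eq by (rule adjoint_unique) (simp add: inner_S_At R_sym)

lemma inner_G: "G x \<bullet> y = x \<bullet> H y"
proof -
  have "S (At (R (A x))) \<bullet> y = R (A x) \<bullet> A (S y)"
    by (rule inner_S_At)
  also have "\<dots> = x \<bullet> At (R (A (S y)))" by (simp add: R_sym inner_A)
  finally show ?thesis by (simp add: G_def H_def inner_diff_left inner_diff_right)
qed

lemma inner_G_pow: "(G ^^ n) x \<bullet> y = x \<bullet> (H ^^ n) y"
  by (induction n arbitrary: y) (simp_all add: inner_G flip: funpow_swap1)

text \<open>\<open>G\<close> is symmetric for the form of \<open>S\<^sup>-\<^sup>1\<close>. On the
  range of \<open>S\<close> that form at \<open>G\<^sup>n (S w)\<close> is the form of
  \<open>S\<close> at \<open>H\<^sup>n w\<close>, so estimates can be stated without an unbounded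
  operator.\<close>

lemma G_pow_S: "(G ^^ n) (S x) = S ((H ^^ n) x)"
  by (induction n) (simp_all add: G_def H_def S_simps)

lemma A_G_pow: "A ((G ^^ n) x) = (D ^^ n) (A x)"
  by (induction n) (simp_all add: G_def A_simps Q_R'[unfolded Q_def])

lemma G_add: "G (x + y) = G x + G y"
  by (simp add: G_def A_simps R_add At_simps S_simps)

lemma G_pow_add: "(G ^^ n) (x + y) = (G ^^ n) x + (G ^^ n) y"
  by (induction n) (simp_all add: G_add)

text \<open>With \<open>w\<close> read as \<open>S\<^sup>-\<^sup>1 x\<close> this is the contraction
  of \<open>G\<close> in the form of \<open>S\<^sup>-\<^sup>1\<close>. After expansion, the
  resolvent equation tested with \<open>R v\<close> shows that all correction terms are
  nonpositive.\<close>

lemma H_form_le: "S (H w) \<bullet> H w \<le> S w \<bullet> w"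
proof -
  define v where "v = A (S w)"
  have 1: "S (At (R v)) \<bullet> w = R v \<bullet> v" "S w \<bullet> At (R v) = R v \<bullet> v"
    using inner_S_At[of "R v" w] sym_S[of w "At (R v)"] by (simp_all add: v_def inner_commute)
  have "S (H w) \<bullet> H w = S w \<bullet> w - 2 * (R v \<bullet> v) + Q (R v) \<bullet> R v"
    by (simp add: H_def flip: v_def) (simp add: S_simps inner_diff_left inner_diff_right 1 Q_form)
  also have "R v \<bullet> v = Q (R v) \<bullet> R v + \<alpha> * (R v \<bullet> R v)"
    using arg_cong[OF Q_R[of v], of "\<lambda>z. R v \<bullet> z"]
    by (simp add: inner_add_right inner_commute)
  finally have "S (H w) \<bullet> H w = S w \<bullet> w - Q (R v) \<bullet> R v - 2 * (\<alpha> * (R v \<bullet> R v))" by simp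
  moreover have "0 \<le> \<alpha> * (R v \<bullet> R v)" using \<alpha>_pos by simp
  moreover have "0 \<le> Q (R v) \<bullet> R v" by (simp add: Q_form pos_S)
  ultimately show ?thesis by linarith
qed

lemma H_pow_form_le: "S ((H ^^ n) w) \<bullet> (H ^^ n) w \<le> S w \<bullet> w"
  by (induction n) (auto intro: order_trans H_form_le)

lemma S_CS: "(S x \<bullet> y)\<^sup>2 \<le> (S x \<bullet> x) * (S y \<bullet> y)"
  by (rule positive_form_Cauchy_Schwarz[OF bounded_linear.linear[OF bounded_linear_S] sym_S pos_S])

text \<open>All powers of \<open>D\<close> are moved onto the test vector \<open>y\<close>.
  Cauchy-Schwarz for the form of \<open>S\<close> then leaves the form of \<open>Q\<close> at
  \<open>D\<^sup>n y\<close>, where smoothing is known.\<close>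

lemma norm_A_G_pow_S:
  assumes "0 < n" shows "(norm (A ((G ^^ n) (S w))))\<^sup>2 \<le> \<alpha> / real n * (S w \<bullet> w)"
proof -
  define y where "y = (D ^^ n) (A (S w))"
  have "(norm y)\<^sup>2 = S w \<bullet> At ((D ^^ n) y)"
    unfolding power2_norm_eq_inner by (subst (1) y_def) (simp add: D_pow_sym inner_A)
  then have "((norm y)\<^sup>2)\<^sup>2 \<le> (S w \<bullet> w) * (Q ((D ^^ n) y) \<bullet> (D ^^ n) y)"
    using S_CS[of w "At ((D ^^ n) y)"] by (simp add: Q_form)
  also have "\<dots> \<le> (S w \<bullet> w) * (\<alpha> / real n * (norm y)\<^sup>2)"
    by (rule mult_left_mono[OF Q_D_pow_form[OF assms] pos_S])
  finally have "((norm y)\<^sup>2)\<^sup>2 \<le> (\<alpha> / real n * (S w \<bullet> w)) * (norm y)\<^sup>2"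
    by (simp only: mult_ac)
  then have "(norm y)\<^sup>2 \<le> \<alpha> / real n * (S w \<bullet> w)"
    unfolding power2_eq_square[of "(norm y)\<^sup>2"]
    by (rule le_if_mult_self_le) (use \<alpha>_pos pos_S in simp_all)
  then show ?thesis by (simp add: A_G_pow y_def)
qed

text \<open>The noise accumulated after \<open>n\<close> steps is \<open>F\<^sub>n \<eta>\<close> with \<open>F\<^sub>n = \<Sum>k<n. G\<^sup>k K\<close>.\<close>

definition Fadj :: "nat \<Rightarrow> 'x \<Rightarrow> 'y" where
  "Fadj n x = (\<Sum>k<n. R ((D ^^ k) (A (S x))))"

text \<open>The adjoint of F_(n+1) = G F_n + K: the term k = 0 is the noise of the newest step, and
  the older noise is propagated once more.\<close>

lemma Fadj_Suc: "Fadj (Suc n) x = Fadj n (H x) + R (A (S x))"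
proof -
  have "A (S (H x)) = D (A (S x))" using A_G_pow[of 1 "S x"] G_pow_S[of 1 x] by simp
  then show ?thesis
    by (simp add: Fadj_def sum.lessThan_Suc_shift funpow_swap1 del: sum.lessThan_Suc)
qed

lemma D_pow_R: "(D ^^ k) (R y) = R ((D ^^ k) y)"
  by (induction k) (simp_all add: D_def R_scaleR)

text \<open>The operator inequality for F_n F_n* by duality: Cauchy-Schwarz for the form of
  \<open>S\<close> separates \<open>x\<close> from \<open>z\<close>, and the form of
  \<open>Q\<close> at \<open>z\<close> is bounded by a telescoped factor of norm at most that of
  \<open>y\<close> and a sum of n resolvent terms.\<close>

lemma norm_Fadj: "(norm (Fadj n x))\<^sup>2 \<le> real n / \<alpha> * (S x \<bullet> x)"
proof -
  define y where "y = Fadj n x"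
  define z where "z = (\<Sum>k<n. R ((D ^^ k) y))"
  have "(norm y)\<^sup>2 = A (S x) \<bullet> z"
    unfolding power2_norm_eq_inner z_def inner_sum_right
    by (subst (1) y_def) (simp add: Fadj_def inner_sum_left R_sym D_pow_sym D_pow_R)
  then have "((norm y)\<^sup>2)\<^sup>2 \<le> (S x \<bullet> x) * (Q z \<bullet> z)"
    using S_CS[of x "At z"] by (simp add: Q_form inner_A)
  also have "\<dots> \<le> (S x \<bullet> x) * (norm y * (real n / \<alpha> * norm y))"
  proof (rule mult_left_mono[OF _ pos_S])
    have "Q z = (\<Sum>k<n. (D ^^ k) y - (D ^^ Suc k) y)"
      unfolding z_def by (simp add: linear_sum[OF bounded_linear.linear[OF bounded_linear_Q]] Q_R')
    also have "\<dots> = y - (D ^^ n) y" by (subst sum_lessThan_telescope') simp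
    finally have Qz: "Q z = y - (D ^^ n) y" .
    \<comment> \<open>Expanding the square, with \<open>q k y\<close> decreasing in
      \<open>k\<close>, avoids the factor 2 of the triangle inequality, which would spoil the
      constant in front of the trace.\<close>
    have "(norm (y - (D ^^ n) y))\<^sup>2 = (norm y)\<^sup>2 - 2 * q n y + q (n + n) y"
      unfolding q_even
      by (simp add: power2_norm_eq_inner inner_diff_left inner_diff_right q_def inner_commute)
    moreover have "q (n + n) y \<le> q n y"
      by (rule lift_Suc_antimono_le[of "\<lambda>k. q k y"]) (use d_nonneg in \<open>auto simp: d_def\<close>)
    ultimately have "(norm (Q z))\<^sup>2 \<le> (norm y)\<^sup>2" using q_nonneg[of n y] Qz by simp
    then have nQ: "norm (Q z) \<le> norm y" by simp
    have "norm (R v) = 1 / \<alpha> * norm (D v)" for v using \<alpha>_pos by (simp add: D_def)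
    then have "norm z \<le> (\<Sum>k<n. 1 / \<alpha> * norm y)"
      unfolding z_def
      by (intro order_trans[OF norm_sum] sum_mono) (use \<alpha>_pos norm_D_pow_le[of "Suc _" y] in \<open>simp add: divide_right_mono\<close>)
    then have nz: "norm z \<le> real n / \<alpha> * norm y" by simp
    have "Q z \<bullet> z \<le> norm (Q z) * norm z" by (rule norm_cauchy_schwarz)
    also have "\<dots> \<le> norm y * (real n / \<alpha> * norm y)" by (intro mult_mono nQ nz) auto
    finally show "Q z \<bullet> z \<le> norm y * (real n / \<alpha> * norm y)" .
  qed
  finally have "((norm y)\<^sup>2)\<^sup>2 \<le> (real n / \<alpha> * (S x \<bullet> x)) * (norm y)\<^sup>2"
    by (simp only: mult_ac power2_eq_square)
  then have "(norm y)\<^sup>2 \<le> real n / \<alpha> * (S x \<bullet> x)"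
    unfolding power2_eq_square[of "(norm y)\<^sup>2"]
    by (rule le_if_mult_self_le) (use \<alpha>_pos pos_S in simp_all)
  then show ?thesis by (simp only: y_def)
qed

end

section \<open>Decay of the bias\<close>

lemma sum_geometric_inj_le:
  fixes \<rho> :: real
  assumes "finite J" "inj_on f J" "0 \<le> \<rho>" "\<rho> < 1"
  shows "(\<Sum>j\<in>J. \<rho> ^ f j) \<le> 1 / (1 - \<rho>)"
proof -
  have "(\<Sum>j\<in>J. \<rho> ^ f j) = (\<Sum>i\<in>f ` J. \<rho> ^ i)" by (simp add: sum.reindex[OF assms(2)])
  also have "\<dots> \<le> (\<Sum>i. \<rho> ^ i)"
    by (rule sum_le_suminf) (use assms in auto)
  also have "\<dots> = 1 / (1 - \<rho>)" by (rule suminf_geometric) (use assms in simp)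
  finally show ?thesis .
qed

lemma norm_add_sq_le: "(norm (x + y))\<^sup>2 \<le> 2 * (norm x)\<^sup>2 + 2 * (norm y)\<^sup>2"
proof -
  have "(norm (x + y))\<^sup>2 \<le> (norm x + norm y)\<^sup>2" by (intro power_mono norm_triangle_ineq) simp
  also have "\<dots> \<le> 2 * (norm x)\<^sup>2 + 2 * (norm y)\<^sup>2"
    using zero_le_power2[of "norm x - norm y"] by (simp add: power2_eq_square algebra_simps)
  finally show ?thesis .
qed

lemma powr_half_sq: "(x powr (r / 2))\<^sup>2 = x powr r" for x r :: real
  by (simp add: power2_eq_square flip: powr_add)

lemma power_powr: "(x ^ k) powr r = (x powr r) ^ k" for x r :: real
  by (induction k) (simp_all add: powr_mult)

lemma dyadic_index:
  fixes l top :: real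
  assumes "0 < l" "l \<le> top"
  obtains j :: nat where "top * (1/2) ^ Suc j < l" "l \<le> top * (1/2) ^ j"
proof -
  have "\<exists>j. top * (1/2) ^ Suc j < l"
  proof -
    obtain n where "(1/2) ^ n < l / top"
      using real_arch_pow_inv[of "l / top" "1/2"] assms by auto
    then have "top * (1/2) ^ n < l" using assms by (simp add: field_simps)
    moreover have "top * (1/2) ^ Suc n \<le> top * (1/2) ^ n" using assms by simp
    ultimately show ?thesis by (meson le_less_trans)
  qed
  define j where "j = (LEAST j. top * (1/2) ^ Suc j < l)"
  have "top * (1/2) ^ Suc j < l" unfolding j_def by (rule LeastI_ex) fact
  moreover have "l \<le> top * (1/2) ^ j"
  proof (cases j)
    case 0
    then show ?thesis using assms by simp
  next
    case (Suc i)
    then have "\<not> top * (1/2) ^ Suc i < l" 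
      using not_less_Least[of i "\<lambda>j. top * (1/2) ^ Suc j < l"] by (simp only: j_def lessI simp_thms)
    then show ?thesis using Suc by simp
  qed
  ultimately show ?thesis by (rule that)
qed

locale smoothing_filter = tikhonov_gain S A \<alpha>
  for S :: "'x::{real_inner,complete_space} \<Rightarrow> 'x"
    and A :: "'x \<Rightarrow> 'y::{real_inner,complete_space}" and \<alpha> :: real +
  fixes a c :: real
  assumes a_pos: "0 < a" and c_pos: "0 < c"
    and norm_A_le: "norm (A x) \<le> c * norm (op_powr S (a/2) x)"
    and norm_A_ge: "norm (op_powr S (a/2) x) \<le> c * norm (A x)"
begin

section \<open>Smoothing measured in powers of \<open>S\<close>, and stability in
  \<open>X\<close>\<close>

abbreviation Z :: "'x \<Rightarrow> 'x" where "Z \<equiv> op_powr S (a/2)"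

lemma P_Z: "0 < l \<Longrightarrow> P l (Z x) = l powr (a/2) *\<^sub>R P l x"
  using P_op_powr[of "a/2" l x] a_pos by simp

lemma norm_Z_has_sum: "((\<lambda>l. l powr a * (norm (P l x))\<^sup>2) has_sum (norm (Z x))\<^sup>2) {0<..}"
  using norm_op_powr_has_sum[of "a/2" x] a_pos by simp

lemma Z_sym: "Z x \<bullet> y = x \<bullet> Z y"
  using op_powr_sym[of "a/2"] a_pos by simp

lemma norm_A_sq: "(norm (A x))\<^sup>2 \<le> c\<^sup>2 * (norm (Z x))\<^sup>2"
  and norm_Z_sq: "(norm (Z x))\<^sup>2 \<le> c\<^sup>2 * (norm (A x))\<^sup>2"
  using power_mono[OF norm_A_le, of x 2] power_mono[OF norm_A_ge, of x 2]
  by (simp_all add: power_mult_distrib)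

text \<open>Dual to \<open>norm_A_G_pow_S\<close>: moving \<open>Z\<close> and the propagator to the
  other side pairs \<open>g\<close> with \<open>Z (G\<^sup>n (S v))\<close>, whose squared norm is
  again controlled by the form at \<open>v\<close> times \<alpha>/n.\<close>

lemma H_pow_form_Z:
  assumes "0 < n"
  shows "S ((H ^^ n) (Z g)) \<bullet> (H ^^ n) (Z g) \<le> c\<^sup>2 * (norm g)\<^sup>2 * (\<alpha> / real n)"
proof -
  define v where "v = (H ^^ n) (Z g)"
  define N where "N = S v \<bullet> v"
  have "S v \<bullet> v = Z g \<bullet> (G ^^ n) (S v)"
  proof -
    have "S v \<bullet> v = (G ^^ n) (S (Z g)) \<bullet> v" by (simp add: v_def G_pow_S)
    also have "\<dots> = S (Z g) \<bullet> (H ^^ n) v" by (rule inner_G_pow)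
    also have "\<dots> = Z g \<bullet> (G ^^ n) (S v)" by (simp add: sym_S G_pow_S)
    finally show ?thesis .
  qed
  also have "\<dots> = g \<bullet> Z ((G ^^ n) (S v))" by (rule Z_sym)
  also have "\<dots> \<le> norm g * norm (Z ((G ^^ n) (S v)))" by (rule norm_cauchy_schwarz)
  finally have "N\<^sup>2 \<le> (norm g)\<^sup>2 * (norm (Z ((G ^^ n) (S v))))\<^sup>2"
    using power_mono[of N "norm g * norm (Z ((G ^^ n) (S v)))" 2] pos_S[of v]
    by (simp add: N_def power_mult_distrib)
  also have "\<dots> \<le> (norm g)\<^sup>2 * (c\<^sup>2 * (\<alpha> / real n * N))"
    unfolding N_def
    by (intro mult_left_mono order_trans[OF norm_Z_sq] norm_A_G_pow_S assms) auto
  finally have "N * N \<le> (c\<^sup>2 * (norm g)\<^sup>2 * (\<alpha> / real n)) * N"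
    by (simp add: power2_eq_square mult_ac)
  moreover have "0 \<le> N" unfolding N_def by (rule pos_S)
  moreover have "0 \<le> c\<^sup>2 * (norm g)\<^sup>2 * (\<alpha> / real n)" using \<alpha>_pos by simp
  ultimately have "N \<le> c\<^sup>2 * (norm g)\<^sup>2 * (\<alpha> / real n)" by (rule le_if_mult_self_le)
  then show ?thesis by (simp only: N_def v_def)
qed

text \<open>The full factor \<alpha>/n, not its square root, appears because the dual vector
  \<open>z\<close> satisfies \<open>A z = Q (D\<^sup>n y)\<close> and \<open>norm_Q_D_pow\<close>
  applies.\<close>

lemma norm_A_G_pow_Z:
  assumes "0 < n"
  shows "norm (A ((G ^^ n) (S (Z g)))) \<le> c * norm g * (\<alpha> / real n)"
proof -
  define y where "y = (D ^^ n) (A (S (Z g)))"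
  define z where "z = S (At ((D ^^ n) y))"
  have "norm y * norm y = y \<bullet> (D ^^ n) (A (S (Z g)))"
    by (simp add: y_def power2_norm_eq_inner flip: power2_eq_square)
  also have "\<dots> = z \<bullet> Z g"
    by (simp add: z_def inner_S_At flip: D_pow_sym)
  also have "\<dots> = Z z \<bullet> g" by (simp add: Z_sym)
  also have "\<dots> \<le> norm (Z z) * norm g" by (rule norm_cauchy_schwarz)
  also have "\<dots> \<le> (c * norm (A z)) * norm g" by (intro mult_right_mono norm_A_ge) simp
  also have "A z = Q ((D ^^ n) y)" by (simp add: z_def Q_def)
  also have "c * norm (Q ((D ^^ n) y)) * norm g \<le> c * (\<alpha> / real n * norm y) * norm g"
    by (intro mult_right_mono mult_left_mono norm_Q_D_pow assms) (use c_pos in auto)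
  finally have "norm y * norm y \<le> (c * norm g * (\<alpha> / real n)) * norm y"
    by (simp add: mult_ac)
  then have "norm y \<le> c * norm g * (\<alpha> / real n)"
    by (rule le_if_mult_self_le) (use c_pos \<alpha>_pos in simp_all)
  then show ?thesis by (simp add: A_G_pow y_def)
qed

text \<open>\<open>x\<close> is split at the upper end \<open>M\<close>. On the block l \<le>
  \<open>M\<close>, so the norm of the upper part is dominated by \<open>M\<close> times the form of
  \<open>S\<^sup>-\<^sup>1\<close>; also l > \<open>m\<close>, so that of the lower part is
  dominated by the form of \<open>S\<^sup>a\<close>, at the cost of \<open>c\<^sup>2\<close> for
  each passage between \<open>Z\<close> and \<open>A\<close>. The bound is kept as a spectral sum
  over \<open>x\<close> so that blocks can be added later.\<close>

lemma block_bound: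
  assumes F: "finite F" "F \<subseteq> {m<..M}" and m: "0 < m" "m < M"
  shows "\<exists>t. ((\<lambda>l. (if M < l then 2 * (M / l) else 2 * c ^ 4 * (l / m) powr a) * (norm (P l x))\<^sup>2) has_sum t) {0<..}
    \<and> (\<Sum>l\<in>F. (norm (P l ((G ^^ n) x)))\<^sup>2) \<le> t"
proof -
  have M: "0 < M" using m by simp
  \<comment> \<open>The preimage under \<open>S\<close> of the part of \<open>x\<close> above
    \<open>M\<close>; the cutoff bounds the multiplier by 1/\<open>M\<close>.\<close>
  define w where "w = mult (\<lambda>l. if M < l then 1 / l else 0) x"
  have Pw: "P l w = (if M < l then 1 / l else 0) *\<^sub>R P l x" if "0 < l" for l
    unfolding w_def by (rule p_mult_bounded[where c="1/M"]) (use that M in \<open>auto simp: frac_le\<close>)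
  define xl where "xl = x - S w"
  have Pxl: "P l xl = (if M < l then 0 else P l x)" if "0 < l" for l
    using that by (simp add: xl_def p_diff P_S Pw)
  define v where "v = (H ^^ n) w"
  define yl where "yl = (G ^^ n) xl"
  have y: "(G ^^ n) x = S v + yl"
    using G_pow_add[of n "S w" xl] by (simp add: xl_def yl_def v_def G_pow_S)
  have l: "0 < l" "m < l" "l \<le> M" if "l \<in> F" for l using that F(2) m by auto
  have high: "(\<Sum>l\<in>F. (norm (P l (S v)))\<^sup>2) \<le> M * (S w \<bullet> w)"
  proof -
    have "(\<Sum>l\<in>F. (norm (P l (S v)))\<^sup>2) \<le> (\<Sum>l\<in>F. M * (l * (norm (P l v))\<^sup>2))"
    proof (rule sum_mono)
      fix l assume "l \<in> F"
      note l = l[OF this]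
      have "(norm (P l (S v)))\<^sup>2 = l * (l * (norm (P l v))\<^sup>2)"
        using l by (simp add: P_S power_mult_distrib power2_eq_square)
      also have "\<dots> \<le> M * (l * (norm (P l v))\<^sup>2)" using l by (intro mult_right_mono) auto
      finally show "(norm (P l (S v)))\<^sup>2 \<le> M * (l * (norm (P l v))\<^sup>2)" .
    qed
    also have "\<dots> = M * (\<Sum>l\<in>F. l * (norm (P l v))\<^sup>2)" by (simp add: sum_distrib_left)
    also have "\<dots> \<le> M * (S v \<bullet> v)"
      by (intro mult_left_mono finite_sum_le_has_sum[OF S_form_has_sum F(1)]) (use l M in auto)
    also have "\<dots> \<le> M * (S w \<bullet> w)" unfolding v_def
      by (intro mult_left_mono H_pow_form_le) (use M in simp)
    finally show ?thesis .
  qed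
  have low: "(\<Sum>l\<in>F. (norm (P l yl))\<^sup>2) \<le> c ^ 4 * (1 / m) powr a * (norm (Z xl))\<^sup>2"
  proof -
    have "(\<Sum>l\<in>F. (norm (P l yl))\<^sup>2) \<le> (\<Sum>l\<in>F. (1 / m) powr a * (l powr a * (norm (P l yl))\<^sup>2))"
    proof (rule sum_mono)
      fix l assume "l \<in> F"
      note l = l[OF this]
      have "1 \<le> (l / m) powr a" using l m a_pos by (intro ge_one_powr_ge_zero) auto
      also have "\<dots> = (1 / m) powr a * l powr a" using l m by (simp flip: powr_mult)
      finally show "(norm (P l yl))\<^sup>2 \<le> (1 / m) powr a * (l powr a * (norm (P l yl))\<^sup>2)"
        using mult_right_mono[of 1 "(1 / m) powr a * l powr a" "(norm (P l yl))\<^sup>2"] by (simp add: mult_ac)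
    qed
    also have "\<dots> = (1 / m) powr a * (\<Sum>l\<in>F. l powr a * (norm (P l yl))\<^sup>2)"
      by (simp add: sum_distrib_left)
    also have "\<dots> \<le> (1 / m) powr a * (norm (Z yl))\<^sup>2"
      by (intro mult_left_mono finite_sum_le_has_sum[OF norm_Z_has_sum F(1)]) (use l in auto)
    also have "\<dots> \<le> (1 / m) powr a * (c ^ 4 * (norm (Z xl))\<^sup>2)"
    proof (rule mult_left_mono)
      have "norm (A yl) \<le> norm (A xl)"
        unfolding yl_def A_G_pow by (rule norm_D_pow_le)
      then have "(norm (A yl))\<^sup>2 \<le> c\<^sup>2 * (norm (Z xl))\<^sup>2"
        by (intro order_trans[OF power_mono norm_A_sq]) auto
      then have "c\<^sup>2 * (norm (A yl))\<^sup>2 \<le> c\<^sup>2 * (c\<^sup>2 * (norm (Z xl))\<^sup>2)"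
        by (rule mult_left_mono) simp
      then show "(norm (Z yl))\<^sup>2 \<le> c ^ 4 * (norm (Z xl))\<^sup>2"
        using norm_Z_sq[of yl] by (simp add: power2_eq_square power4_eq_xxxx mult_ac)
    qed simp
    finally show ?thesis by (simp only: mult_ac)
  qed
  let ?t = "2 * (M * (S w \<bullet> w)) + 2 * (c ^ 4 * (1 / m) powr a * (norm (Z xl))\<^sup>2)"
  have "(\<Sum>l\<in>F. (norm (P l ((G ^^ n) x)))\<^sup>2) \<le> (\<Sum>l\<in>F. 2 * (norm (P l (S v)))\<^sup>2 + 2 * (norm (P l yl))\<^sup>2)"
    by (rule sum_mono) (use l(1) in \<open>simp add: y p_add norm_add_sq_le\<close>)
  also have "\<dots> = 2 * (\<Sum>l\<in>F. (norm (P l (S v)))\<^sup>2) + 2 * (\<Sum>l\<in>F. (norm (P l yl))\<^sup>2)"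
    by (simp add: sum.distrib sum_distrib_left)
  also have "\<dots> \<le> ?t" using high low by simp
  finally have le: "(\<Sum>l\<in>F. (norm (P l ((G ^^ n) x)))\<^sup>2) \<le> ?t" .
  have "((\<lambda>l. 2 * (M * (l * (norm (P l w))\<^sup>2)) +
      2 * (c ^ 4 * (1 / m) powr a * (l powr a * (norm (P l xl))\<^sup>2))) has_sum ?t) {0<..}"
    by (intro has_sum_add has_sum_cmult_right S_form_has_sum norm_Z_has_sum)
  moreover have "2 * (M * (l * (norm (P l w))\<^sup>2)) + 2 * (c ^ 4 * (1 / m) powr a * (l powr a * (norm (P l xl))\<^sup>2))
     = (if M < l then 2 * (M / l) else 2 * c ^ 4 * (l / m) powr a) * (norm (P l x))\<^sup>2"
    if "l \<in> {0<..}" for l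
  proof (cases "M < l")
    case True
    then show ?thesis using that by (simp add: Pw Pxl power_mult_distrib power2_eq_square)
  next
    case False
    have "(l / m) powr a = (1 / m) powr a * l powr a" using that m by (simp flip: powr_mult)
    then show ?thesis using that False by (simp add: Pw Pxl)
  qed
  ultimately have "((\<lambda>l. (if M < l then 2 * (M / l) else 2 * c ^ 4 * (l / m) powr a) * (norm (P l x))\<^sup>2) has_sum ?t) {0<..}"
    by (rule has_sum_cong[THEN iffD1, rotated])
  with le show ?thesis by blast
qed

text \<open>Both geometric series of \<open>grid_sum_le\<close>, doubled by
  \<open>norm_add_sq_le\<close>. Ratio 1/2 gives 4; ratio 2^(-a) gives the rest, with 2^a because
  the weight refers to the lower end of a block.\<close>

definition C0 :: real where "C0 = 4 + 2 * c ^ 4 * 2 powr a / (1 - (1/2) powr a)"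

lemma half_powr_a: "0 < (1/2) powr a" "(1/2::real) powr a < 1"
  using a_pos powr_less_mono2[of a "1/2" "1"] by auto

lemma C0_nonneg: "0 \<le> C0"
  using half_powr_a c_pos by (auto simp: C0_def)

text \<open>For fixed l the levels below l contribute a series with ratio 1/2 starting at the first
  such index \<open>j0\<close>, and the others one with ratio 2^(-a) running backwards from the last
  such index \<open>j1\<close>.\<close>

lemma grid_sum_le:
  assumes J: "finite J" and L0: "0 < L0" and l: "0 < l"
  shows "(\<Sum>j\<in>J. if L0 * (1/2) ^ j < l then 2 * (L0 * (1/2) ^ j / l)
      else 2 * c ^ 4 * (l / (L0 * (1/2) ^ Suc j)) powr a) \<le> C0"
proof -
  define \<mu> where "\<mu> j = L0 * (1/2) ^ j" for j :: nat
  have \<mu>_pos: "0 < \<mu> j" for j using L0 by (simp add: \<mu>_def)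
  have \<mu>_add: "\<mu> (j + i) = \<mu> j * (1/2) ^ i" for i j by (simp add: \<mu>_def power_add)
  define J1 where "J1 = {j \<in> J. \<mu> j < l}"
  define J2 where "J2 = {j \<in> J. \<not> \<mu> j < l}"
  have fin: "finite J1" "finite J2" using J by (auto simp: J1_def J2_def)
  have high: "(\<Sum>j\<in>J1. \<mu> j / l) \<le> 2"
  proof (cases "J1 = {}")
    case False
    define j0 where "j0 = Min J1"
    have j0: "j0 \<in> J1" "\<And>j. j \<in> J1 \<Longrightarrow> j0 \<le> j"
      using fin(1) False by (auto simp: j0_def)
    have "(\<Sum>j\<in>J1. \<mu> j / l) \<le> (\<Sum>j\<in>J1. (1/2) ^ (j - j0))"
    proof (rule sum_mono)
      fix j assume "j \<in> J1"
      then have "\<mu> j = \<mu> j0 * (1/2) ^ (j - j0)" using \<mu>_add[of j0 "j - j0"] j0(2) by simp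
      moreover have "\<mu> j0 / l \<le> 1" using j0(1) l by (simp add: J1_def)
      ultimately show "\<mu> j / l \<le> (1/2) ^ (j - j0)"
        using mult_right_mono[of "\<mu> j0 / l" 1 "(1/2) ^ (j - j0)"] by simp
    qed
    also have "\<dots> \<le> 1 / (1 - 1/2)"
      by (rule sum_geometric_inj_le[OF fin(1)]) (use j0(2) in \<open>auto intro!: inj_onI simp: eq_diff_iff\<close>)
    finally show ?thesis by simp
  qed simp
  have low: "(\<Sum>j\<in>J2. (l / \<mu> (Suc j)) powr a) \<le> 2 powr a / (1 - (1/2) powr a)"
  proof (cases "J2 = {}")
    case True
    then show ?thesis using half_powr_a by simp
  next
    case False
    define j1 where "j1 = Max J2"
    have j1: "j1 \<in> J2" "\<And>j. j \<in> J2 \<Longrightarrow> j \<le> j1"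
      using fin(2) False by (auto simp: j1_def)
    have "(\<Sum>j\<in>J2. (l / \<mu> (Suc j)) powr a) \<le> (\<Sum>j\<in>J2. 2 powr a * ((1/2) powr a) ^ (j1 - j))"
    proof (rule sum_mono)
      fix j assume "j \<in> J2"
      then have "\<mu> j1 = \<mu> j * (1/2) ^ (j1 - j)" using \<mu>_add[of j "j1 - j"] j1(2) by simp
      moreover have "l \<le> \<mu> j1" using j1(1) by (simp add: J2_def)
      ultimately have "l \<le> (1/2) ^ (j1 - j) * \<mu> j" by (simp only: mult.commute)
      then have "l / \<mu> j \<le> (1/2) ^ (j1 - j)"
        by (simp only: pos_divide_le_eq[OF \<mu>_pos])
      moreover have "l / \<mu> (Suc j) = 2 * (l / \<mu> j)" by (simp add: \<mu>_def)
      ultimately have "l / \<mu> (Suc j) \<le> 2 * (1/2) ^ (j1 - j)" by linarith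
      then have "(l / \<mu> (Suc j)) powr a \<le> (2 * (1/2) ^ (j1 - j)) powr a"
        using l \<mu>_pos[of "Suc j"] a_pos by (intro powr_mono2) auto
      also have "\<dots> = 2 powr a * ((1/2) powr a) ^ (j1 - j)"
        by (simp only: powr_mult power_powr)
      finally show "(l / \<mu> (Suc j)) powr a \<le> 2 powr a * ((1/2) powr a) ^ (j1 - j)" .
    qed
    also have "\<dots> = 2 powr a * (\<Sum>j\<in>J2. ((1/2) powr a) ^ (j1 - j))" by (simp add: sum_distrib_left)
    also have "\<dots> \<le> 2 powr a * (1 / (1 - (1/2) powr a))"
    proof (rule mult_left_mono)
      have "inj_on (\<lambda>j. j1 - j) J2"
      proof (rule inj_onI)
        fix i j assume "i \<in> J2" "j \<in> J2" "j1 - i = j1 - j"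
        then show "i = j" using j1(2)[of i] j1(2)[of j] by linarith
      qed
      then show "(\<Sum>j\<in>J2. ((1/2) powr a) ^ (j1 - j)) \<le> 1 / (1 - (1/2) powr a)"
        by (rule sum_geometric_inj_le[OF fin(2)]) (use half_powr_a in auto)
    qed simp
    finally show ?thesis by simp
  qed
  have "J1 = J \<inter> {j. \<mu> j < l}" "J2 = J \<inter> - {j. \<mu> j < l}" by (auto simp: J1_def J2_def)
  then have "(\<Sum>j\<in>J. if \<mu> j < l then 2 * (\<mu> j / l) else 2 * c ^ 4 * (l / \<mu> (Suc j)) powr a)
      = (\<Sum>j\<in>J1. 2 * (\<mu> j / l)) + (\<Sum>j\<in>J2. 2 * c ^ 4 * (l / \<mu> (Suc j)) powr a)"
    by (simp only: sum.If_cases[OF J])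
  also have "\<dots> = 2 * (\<Sum>j\<in>J1. \<mu> j / l) + 2 * c ^ 4 * (\<Sum>j\<in>J2. (l / \<mu> (Suc j)) powr a)"
    by (simp add: sum_distrib_left)
  also have "\<dots> \<le> 2 * 2 + 2 * c ^ 4 * (2 powr a / (1 - (1/2) powr a))"
    by (rule add_mono[OF mult_left_mono[OF high] mult_left_mono[OF low]]) (use c_pos in simp_all)
  also have "\<dots> = C0" by (simp add: C0_def)
  finally show ?thesis unfolding \<mu>_def .
qed

text \<open>\<open>G\<close> is a contraction for the form of \<open>S\<^sup>-\<^sup>1\<close> and power bounded for \<open>\<parallel>A x\<parallel>\<close>. On each dyadic block of
  the spectrum of \<open>S\<close> the input is split at that block, the upper part being controlled by the
  former and the lower part by the latter. Summing geometric series interpolates between the two.\<close>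

lemma G_pow_bounded: "(norm ((G ^^ n) x))\<^sup>2 \<le> C0 * (norm x)\<^sup>2"
proof (rule has_sum_le_finite_sums[OF Parseval])
  fix F0 :: "real set" assume F0: "finite F0" "F0 \<subseteq> {0<..}"
  let ?y = "(G ^^ n) x"
  \<comment> \<open>No eigenvalue exceeds \<open>L\<close>, so the discarded terms vanish and the
    dyadic levels below \<open>L\<close> cover what is left.\<close>
  define F where "F = {l \<in> F0. l \<le> L}"
  have F: "finite F" "\<And>l. l \<in> F \<Longrightarrow> 0 < l" "\<And>l. l \<in> F \<Longrightarrow> l \<le> L"
    using F0 by (auto simp: F_def)
  define \<mu> where "\<mu> j = L * (1/2) ^ j" for j :: nat
  have "\<forall>l\<in>F. \<exists>j. \<mu> (Suc j) < l \<and> l \<le> \<mu> j"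
    unfolding \<mu>_def using dyadic_index[OF F(2,3)] by blast
  from bchoice[OF this] obtain idx where idx: "\<forall>l\<in>F. \<mu> (Suc (idx l)) < l \<and> l \<le> \<mu> (idx l)" ..
  let ?b = "\<lambda>j l. if \<mu> j < l then 2 * (\<mu> j / l) else 2 * c ^ 4 * (l / \<mu> (Suc j)) powr a"
  have "\<exists>t. ((\<lambda>l. ?b j l * (norm (P l x))\<^sup>2) has_sum t) {0<..}
    \<and> (\<Sum>l\<in>{l \<in> F. idx l = j}. (norm (P l ?y))\<^sup>2) \<le> t" for j
  proof (rule block_bound)
    show "{l \<in> F. idx l = j} \<subseteq> {\<mu> (Suc j)<..\<mu> j}" using idx by auto
  qed (use F(1) L_pos in \<open>simp_all add: \<mu>_def\<close>)
  then have "\<forall>j. \<exists>t. ((\<lambda>l. ?b j l * (norm (P l x))\<^sup>2) has_sum t) {0<..}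
    \<and> (\<Sum>l\<in>{l \<in> F. idx l = j}. (norm (P l ?y))\<^sup>2) \<le> t" ..
  from choice[OF this] obtain t where t': "\<forall>j. ((\<lambda>l. ?b j l * (norm (P l x))\<^sup>2) has_sum t j) {0<..}
    \<and> (\<Sum>l\<in>{l \<in> F. idx l = j}. (norm (P l ?y))\<^sup>2) \<le> t j" ..
  note t = conjunct1[OF spec[OF t']] conjunct2[OF spec[OF t']]
  have finJ: "finite (idx ` F)" using F(1) by simp
  have "(\<Sum>l\<in>F0. (norm (P l ?y))\<^sup>2) = (\<Sum>l\<in>F. (norm (P l ?y))\<^sup>2)"
    by (rule sum.mono_neutral_right) (use F0 eigenvalue_le[of _ ?y] in \<open>auto simp: F_def\<close>)
  also have "\<dots> = (\<Sum>j\<in>idx ` F. \<Sum>l\<in>{l \<in> F. idx l = j}. (norm (P l ?y))\<^sup>2)"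
    by (rule sum.image_gen[OF F(1)])
  also have "\<dots> \<le> (\<Sum>j\<in>idx ` F. t j)" by (rule sum_mono[OF t(2)])
  also have "\<dots> \<le> C0 * (norm x)\<^sup>2"
  \<comment> \<open>The order of summation is exchanged: blocks are summed at each fixed spectral
    value of \<open>x\<close>.\<close>
  proof (rule has_sum_mono)
    have "((\<lambda>l. \<Sum>j\<in>J. ?b j l * (norm (P l x))\<^sup>2) has_sum (\<Sum>j\<in>J. t j)) {0<..}" if "finite J" for J
      using that
    proof (induction J)
      case (insert j J)
      from has_sum_add[OF t(1)[of j] insert.IH] show ?case by (simp only: sum.insert[OF insert.hyps])
    qed simp
    from this[OF finJ] show "((\<lambda>l. \<Sum>j\<in>idx ` F. ?b j l * (norm (P l x))\<^sup>2) has_sum (\<Sum>j\<in>idx ` F. t j)) {0<..}" .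
    show "((\<lambda>l. C0 * (norm (P l x))\<^sup>2) has_sum C0 * (norm x)\<^sup>2) {0<..}"
      by (rule has_sum_cmult_right[OF Parseval])
    fix l :: real assume "l \<in> {0<..}"
    then have l: "0 < l" by simp
    have le: "(\<Sum>j\<in>idx ` F. ?b j l) \<le> C0"
      unfolding \<mu>_def by (rule grid_sum_le[OF finJ L_pos l])
    have "(\<Sum>j\<in>idx ` F. ?b j l * (norm (P l x))\<^sup>2) = (\<Sum>j\<in>idx ` F. ?b j l) * (norm (P l x))\<^sup>2"
      by (rule sum_distrib_right[symmetric])
    also have "\<dots> \<le> C0 * (norm (P l x))\<^sup>2" by (rule mult_right_mono[OF le]) simp
    finally show "(\<Sum>j\<in>idx ` F. ?b j l * (norm (P l x))\<^sup>2) \<le> C0 * (norm (P l x))\<^sup>2" .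
  qed
  finally show "(\<Sum>l\<in>F0. (norm (P l ?y))\<^sup>2) \<le> C0 * (norm x)\<^sup>2" .
qed

text \<open>Integrates \<open>1 \<le> \<mu>/l + (l/\<mu>)\<^sup>a\<close> against the spectral measure of \<open>S v\<close>.\<close>

lemma norm_S_interpolation:
  assumes "0 < \<mu>"
  shows "(norm (S v))\<^sup>2 \<le> \<mu> * (S v \<bullet> v) + \<mu> powr (-a) * (norm (Z (S v)))\<^sup>2"
proof (rule has_sum_mono[OF Parseval])
  show "((\<lambda>l. \<mu> * (l * (norm (P l v))\<^sup>2) + \<mu> powr (-a) * (l powr a * (norm (P l (S v)))\<^sup>2))
      has_sum \<mu> * (S v \<bullet> v) + \<mu> powr (-a) * (norm (Z (S v)))\<^sup>2) {0<..}"
    by (intro has_sum_add has_sum_cmult_right S_form_has_sum norm_Z_has_sum)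
  fix l :: real assume "l \<in> {0<..}"
  then have l: "0 < l" by simp
  define p where "p = (norm (P l v))\<^sup>2"
  have eq: "(norm (P l (S v)))\<^sup>2 = l * (l * p)"
    using l by (simp add: P_S p_def power_mult_distrib power2_eq_square)
  show "(norm (P l (S v)))\<^sup>2 \<le> \<mu> * (l * (norm (P l v))\<^sup>2) + \<mu> powr (-a) * (l powr a * (norm (P l (S v)))\<^sup>2)"
    unfolding eq unfolding p_def[symmetric]
  proof (cases "l \<le> \<mu>")
    case True
    have "l * (l * p) \<le> \<mu> * (l * p)" using True l by (intro mult_right_mono) (auto simp: p_def)
    also have "\<dots> \<le> \<mu> * (l * p) + \<mu> powr (-a) * (l powr a * (l * (l * p)))" using l by (simp add: p_def)
    finally show "l * (l * p) \<le> \<mu> * (l * p) + \<mu> powr (-a) * (l powr a * (l * (l * p)))" .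
  next
    case False
    have "1 \<le> (l / \<mu>) powr a" using False assms a_pos by (intro ge_one_powr_ge_zero) auto
    also have "\<dots> = \<mu> powr (-a) * l powr a"
      using l assms by (simp add: powr_divide powr_minus_divide)
    finally have "1 * (l * (l * p)) \<le> \<mu> powr (-a) * l powr a * (l * (l * p))"
      using l by (intro mult_right_mono) (auto simp: p_def)
    moreover have "0 \<le> \<mu> * (l * p)" using l assms by (simp add: p_def)
    ultimately show "l * (l * p) \<le> \<mu> * (l * p) + \<mu> powr (-a) * (l powr a * (l * (l * p)))"
      by (simp add: mult_ac)
  qed
qed

lemma bias_bound:
  assumes n: "0 < n" and s: "0 \<le> s" "s \<le> a + 2"
    and e0: "\<And>l. 0 < l \<Longrightarrow> P l e0 = l powr (s/2) *\<^sub>R P l w"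
  shows "(norm ((G ^^ n) e0))\<^sup>2 \<le> 2 * (C0 + c\<^sup>2 + c ^ 4) * (norm w)\<^sup>2 * (\<alpha> / real n) powr (s / (a + 1))"
proof -
  define \<epsilon> where "\<epsilon> = \<alpha> / real n"
  define \<mu> where "\<mu> = \<epsilon> powr (1 / (a + 1))"
  have \<epsilon>: "0 < \<epsilon>" using n \<alpha>_pos by (simp add: \<epsilon>_def)
  then have \<mu>: "0 < \<mu>" by (simp add: \<mu>_def)
  have \<epsilon>_eq: "\<epsilon> = \<mu> powr (a + 1)" using \<epsilon> a_pos by (simp add: \<mu>_def powr_powr)
  have \<mu>_s: "\<mu> powr s = \<epsilon> powr (s / (a + 1))" by (simp add: \<mu>_def powr_powr)
  \<comment> \<open>Designed so that \<open>S (Z g)\<close> is the part of \<open>e0\<close> above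
    \<mu>. As s \<le> a + 2 the exponent is nonpositive, and the multiplier is at most its value at
    \<mu>.\<close>
  define g where "g = mult (\<lambda>l. if \<mu> < l then l powr ((s - (a + 2)) / 2) else 0) w"
  have le: "l powr ((s - (a + 2)) / 2) \<le> \<mu> powr ((s - (a + 2)) / 2)" if "\<mu> < l" for l
    using that \<mu> s by (intro powr_mono2') auto
  have Pg: "P l g = (if \<mu> < l then l powr ((s - (a + 2)) / 2) else 0) *\<^sub>R P l w" if "0 < l" for l
    unfolding g_def by (rule p_mult_bounded[where c="\<mu> powr ((s - (a + 2)) / 2)"])
      (use that le in auto)
  have norm_g: "(norm g)\<^sup>2 \<le> \<mu> powr (s - (a + 2)) * (norm w)\<^sup>2"
  proof (rule norm_le_if_coeff_le)
    fix l :: real assume "l \<in> {0<..}"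
    then have "norm (P l g) \<le> \<mu> powr ((s - (a + 2)) / 2) * norm (P l w)"
      using le[of l] by (simp add: Pg mult_right_mono)
    then have "(norm (P l g))\<^sup>2 \<le> (\<mu> powr ((s - (a + 2)) / 2) * norm (P l w))\<^sup>2" by (rule power_mono) simp
    then show "(norm (P l g))\<^sup>2 \<le> \<mu> powr (s - (a + 2)) * (norm (P l w))\<^sup>2"
      by (simp only: power_mult_distrib powr_half_sq)
  qed
  define xl where "xl = e0 - S (Z g)"
  have high_eq: "l * (l powr (a/2) * l powr ((s - (a + 2)) / 2)) = l powr (s/2)" if "0 < l" for l :: real
  proof -
    have "l * (l powr (a/2) * l powr ((s - (a + 2)) / 2)) = l powr (1 + (a/2 + (s - (a + 2)) / 2))"
      using that by (simp only: powr_add powr_one)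
    also have "1 + (a/2 + (s - (a + 2)) / 2) = s / 2" by (simp add: field_simps)
    finally show ?thesis .
  qed
  have Pxl: "P l xl = (if \<mu> < l then 0 else l powr (s/2) *\<^sub>R P l w)" if "0 < l" for l
    using that high_eq[OF that] by (simp add: xl_def p_diff P_S P_Z Pg e0)
  have "(norm xl)\<^sup>2 \<le> \<mu> powr s * (norm w)\<^sup>2"
  proof (rule norm_le_if_coeff_le)
    fix l :: real assume l: "l \<in> {0<..}"
    have "l powr (s/2) \<le> \<mu> powr (s/2)" if "\<not> \<mu> < l" using that l s by (intro powr_mono2) auto
    then have "norm (P l xl) \<le> \<mu> powr (s/2) * norm (P l w)"
      using l by (simp add: Pxl mult_right_mono)
    then have "(norm (P l xl))\<^sup>2 \<le> (\<mu> powr (s/2) * norm (P l w))\<^sup>2" by (rule power_mono) simp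
    then show "(norm (P l xl))\<^sup>2 \<le> \<mu> powr s * (norm (P l w))\<^sup>2"
      by (simp only: power_mult_distrib powr_half_sq)
  qed
  then have low: "(norm ((G ^^ n) xl))\<^sup>2 \<le> C0 * (\<mu> powr s * (norm w)\<^sup>2)"
    by (intro order_trans[OF G_pow_bounded] mult_left_mono C0_nonneg)
  define v where "v = (H ^^ n) (Z g)"
  have Sv: "S v = (G ^^ n) (S (Z g))" by (simp add: v_def G_pow_S)
  have "(norm (Z (S v)))\<^sup>2 \<le> c\<^sup>2 * (c * norm g * \<epsilon>)\<^sup>2"
    unfolding Sv \<epsilon>_def
    by (intro order_trans[OF norm_Z_sq] mult_left_mono power_mono norm_A_G_pow_Z n) auto
  moreover have "S v \<bullet> v \<le> c\<^sup>2 * (norm g)\<^sup>2 * \<epsilon>"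
    unfolding v_def \<epsilon>_def by (rule H_pow_form_Z[OF n])
  ultimately have "\<mu> * (S v \<bullet> v) + \<mu> powr (-a) * (norm (Z (S v)))\<^sup>2
      \<le> \<mu> * (c\<^sup>2 * (norm g)\<^sup>2 * \<epsilon>) + \<mu> powr (-a) * (c\<^sup>2 * (c * norm g * \<epsilon>)\<^sup>2)"
    using \<mu> by (intro add_mono mult_left_mono) auto
  also have "\<dots> = (c\<^sup>2 * (\<mu> * \<epsilon>) + c ^ 4 * (\<mu> powr (-a) * (\<epsilon> * \<epsilon>))) * (norm g)\<^sup>2"
    by (simp add: power_mult_distrib power2_eq_square power4_eq_xxxx algebra_simps)
  also have "\<mu> * \<epsilon> = \<mu> powr (a + 2)"
  proof -
    have "\<mu> * \<epsilon> = \<mu> powr (1 + (a + 1))" using \<mu> by (simp only: \<epsilon>_eq powr_add powr_one)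
    then show ?thesis by (simp add: add.commute)
  qed
  also have "\<mu> powr (-a) * (\<epsilon> * \<epsilon>) = \<mu> powr (a + 2)"
  proof -
    have "\<mu> powr (-a) * (\<epsilon> * \<epsilon>) = \<mu> powr (-a + ((a + 1) + (a + 1)))" by (simp only: \<epsilon>_eq powr_add)
    then show ?thesis by (simp add: add.commute)
  qed
  also have "(c\<^sup>2 * \<mu> powr (a + 2) + c ^ 4 * \<mu> powr (a + 2)) * (norm g)\<^sup>2
      \<le> (c\<^sup>2 * \<mu> powr (a + 2) + c ^ 4 * \<mu> powr (a + 2)) * (\<mu> powr (s - (a + 2)) * (norm w)\<^sup>2)"
    by (intro mult_left_mono norm_g) auto
  also have "\<dots> = (c\<^sup>2 + c ^ 4) * (\<mu> powr (a + 2) * \<mu> powr (s - (a + 2))) * (norm w)\<^sup>2"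
    by (simp add: algebra_simps)
  also have "\<mu> powr (a + 2) * \<mu> powr (s - (a + 2)) = \<mu> powr s"
    by (simp flip: powr_add)
  finally have high: "(norm (S v))\<^sup>2 \<le> (c\<^sup>2 + c ^ 4) * \<mu> powr s * (norm w)\<^sup>2"
    using norm_S_interpolation[OF \<mu>, of v] by linarith
  have "(G ^^ n) e0 = S v + (G ^^ n) xl"
    using G_pow_add[of n "S (Z g)" xl] by (simp add: xl_def Sv)
  then have "(norm ((G ^^ n) e0))\<^sup>2 \<le> 2 * (norm (S v))\<^sup>2 + 2 * (norm ((G ^^ n) xl))\<^sup>2"
    by (simp add: norm_add_sq_le)
  also have "\<dots> \<le> 2 * ((c\<^sup>2 + c ^ 4) * \<mu> powr s * (norm w)\<^sup>2) + 2 * (C0 * (\<mu> powr s * (norm w)\<^sup>2))"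
    using high low by simp
  also have "\<dots> = 2 * (C0 + c\<^sup>2 + c ^ 4) * (norm w)\<^sup>2 * \<mu> powr s" by (simp add: algebra_simps)
  finally show ?thesis by (simp only: \<mu>_s \<epsilon>_def)
qed

end

section \<open>Mean square error\<close>

lemma white_noise_zero:
  assumes "white_noise M \<gamma> \<eta>" shows "AE \<omega> in M. \<eta> 0 \<omega> = 0"
proof -
  have "AE \<omega> in M. \<eta> (0 *\<^sub>R 0 + 0 *\<^sub>R 0) \<omega> = 0 * \<eta> 0 \<omega> + 0 * \<eta> 0 \<omega>"
    using assms unfolding white_noise_def by blast
  then show ?thesis by simp
qed

lemma white_noise_add:
  assumes "white_noise M \<gamma> \<eta>" shows "AE \<omega> in M. \<eta> (h + k) \<omega> = \<eta> h \<omega> + \<eta> k \<omega>"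
proof -
  have "AE \<omega> in M. \<eta> (1 *\<^sub>R h + 1 *\<^sub>R k) \<omega> = 1 * \<eta> h \<omega> + 1 * \<eta> k \<omega>"
    using assms unfolding white_noise_def by blast
  then show ?thesis by simp
qed

lemma normal_shifted_second_moment:
  fixes \<sigma> b :: real
  assumes "0 < \<sigma>"
  shows "has_bochner_integral lborel (\<lambda>x. normal_density 0 \<sigma> x * (b + x)\<^sup>2) (b\<^sup>2 + \<sigma>\<^sup>2)"
proof -
  have "has_bochner_integral lborel (normal_density 0 \<sigma>) 1"
    using assms by (simp add: has_bochner_integral_iff)
  moreover have "has_bochner_integral lborel (\<lambda>x. normal_density 0 \<sigma> x * x) 0"
    by (rule normal_moment_nz_1[OF assms])
  moreover have "has_bochner_integral lborel (\<lambda>x. normal_density 0 \<sigma> x * x\<^sup>2) (\<sigma>\<^sup>2)"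
    using normal_moment_even[OF assms, of 0 1] by (simp add: power2_eq_square)
  ultimately have "has_bochner_integral lborel (\<lambda>x. b\<^sup>2 * normal_density 0 \<sigma> x
      + 2 * b * (normal_density 0 \<sigma> x * x) + normal_density 0 \<sigma> x * x\<^sup>2) (b\<^sup>2 * 1 + 2 * b * 0 + \<sigma>\<^sup>2)"
    by (intro has_bochner_integral_add has_bochner_integral_mult_right)
  then show ?thesis by (simp add: power2_eq_square algebra_simps)
qed

text \<open>At h = 0 there is no density and linearity gives the value 0 almost everywhere;
  otherwise the cross term vanishes because the noise is centred.\<close>

lemma white_noise_second_moment:
  assumes M: "prob_space M" and \<gamma>: "0 < \<gamma>" and wn: "white_noise M \<gamma> \<eta>"
  shows "(\<integral>\<^sup>+\<omega>. ennreal ((b + \<eta> h \<omega>)\<^sup>2) \<partial>M) = ennreal (b\<^sup>2 + \<gamma>\<^sup>2 * (norm h)\<^sup>2)"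
proof (cases "h = 0")
  case True
  interpret prob_space M by fact
  have "(\<integral>\<^sup>+\<omega>. ennreal ((b + \<eta> h \<omega>)\<^sup>2) \<partial>M) = (\<integral>\<^sup>+\<omega>. ennreal (b\<^sup>2) \<partial>M)"
    by (rule nn_integral_cong_AE) (use white_noise_zero[OF wn] True in auto)
  then show ?thesis using True by (simp add: emeasure_space_1)
next
  case False
  interpret prob_space M by fact
  let ?f = "normal_density 0 (\<gamma> * norm h)"
  have D: "distributed M lborel (\<eta> h) ?f" using wn False unfolding white_noise_def by blast
  have hb: "has_bochner_integral lborel (\<lambda>x. ?f x * (b + x)\<^sup>2) (b\<^sup>2 + (\<gamma> * norm h)\<^sup>2)"
    using normal_shifted_second_moment[of "\<gamma> * norm h" b] \<gamma> False by simp
  have "integrable M (\<lambda>\<omega>. (b + \<eta> h \<omega>)\<^sup>2)"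
    using distributed_integrable[OF D, of "\<lambda>x. (b + x)\<^sup>2"] hb by (simp add: has_bochner_integral_iff)
  moreover have "(\<integral>\<omega>. (b + \<eta> h \<omega>)\<^sup>2 \<partial>M) = b\<^sup>2 + (\<gamma> * norm h)\<^sup>2"
    using distributed_integral[OF D, of "\<lambda>x. (b + x)\<^sup>2"] hb by (simp add: has_bochner_integral_iff)
  ultimately show ?thesis by (simp add: nn_integral_eq_integral power_mult_distrib)
qed

text \<open>\<open>has_sum\<close> converges along the net of finite subsets, whereas Fatou's lemma
  concerns sequences; this extracts a cofinal sequence.\<close>

lemma finite_exhaustion:
  assumes "countable E"
  obtains F :: "nat \<Rightarrow> 'a set" where "\<And>k. finite (F k)" "\<And>k. F k \<subseteq> E"
    "filterlim F (finite_subsets_at_top E) sequentially"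
proof
  let ?F = "\<lambda>k. to_nat_on E -` {..<k} \<inter> E"
  show fin: "finite (?F k)" for k
    by (rule finite_vimage_IntI) (use assms inj_on_to_nat_on in auto)
  show "?F k \<subseteq> E" for k by blast
  show "filterlim ?F (finite_subsets_at_top E) sequentially"
    unfolding filterlim_finite_subsets_at_top
  proof (intro allI impI)
    fix X assume X: "finite X \<and> X \<subseteq> E"
    have "\<forall>\<^sub>F k in sequentially. \<forall>e\<in>X. to_nat_on E e < k"
      using X by (intro eventually_ball_finite ballI eventually_gt_at_top) auto
    then show "\<forall>\<^sub>F k in sequentially. finite (?F k) \<and> X \<subseteq> ?F k \<and> ?F k \<subseteq> E"
      by eventually_elim (use X fin in auto)
  qed
qed

text \<open>By Parseval and Fatou, a bound on all finite coordinate sums suffices.\<close>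

lemma nn_integral_norm_sq_le:
  fixes Y :: "'w \<Rightarrow> 'a::{real_inner,complete_space}"
  assumes E: "orthonormal_basis E" "countable E" and Y: "Y \<in> borel_measurable M"
    and le: "\<And>F. finite F \<Longrightarrow> F \<subseteq> E \<Longrightarrow> (\<Sum>e\<in>F. \<integral>\<^sup>+\<omega>. ennreal ((Y \<omega> \<bullet> e)\<^sup>2) \<partial>M) \<le> B"
  shows "(\<integral>\<^sup>+\<omega>. ennreal ((norm (Y \<omega>))\<^sup>2) \<partial>M) \<le> B"
proof -
  obtain F :: "nat \<Rightarrow> 'a set" where F: "\<And>k. finite (F k)" "\<And>k. F k \<subseteq> E"
    "filterlim F (finite_subsets_at_top E) sequentially"
    using finite_exhaustion[OF E(2)] by metis
  have meas: "(\<lambda>\<omega>. ennreal ((Y \<omega> \<bullet> e)\<^sup>2)) \<in> borel_measurable M" for e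
  proof -
    have "(\<lambda>y. (y \<bullet> e)\<^sup>2) \<in> borel_measurable borel"
      by (intro borel_measurable_continuous_onI continuous_intros)
    from measurable_compose[OF Y this] show ?thesis by simp
  qed
  let ?s = "\<lambda>k \<omega>. \<Sum>e\<in>F k. ennreal ((Y \<omega> \<bullet> e)\<^sup>2)"
  have "liminf (\<lambda>k. ?s k \<omega>) = ennreal ((norm (Y \<omega>))\<^sup>2)" for \<omega>
  proof (rule lim_imp_Liminf)
    have "(\<lambda>k. \<Sum>e\<in>F k. (Y \<omega> \<bullet> e)\<^sup>2) \<longlonglongrightarrow> (norm (Y \<omega>))\<^sup>2"
      using filterlim_compose[OF orthonormal_basis_Parseval[OF E(1), unfolded has_sum_def] F(3)]
      by (simp add: o_def)
    from tendsto_ennrealI[OF this]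
    show "(\<lambda>k. ?s k \<omega>) \<longlonglongrightarrow> ennreal ((norm (Y \<omega>))\<^sup>2)" by simp
  qed simp
  then have "(\<integral>\<^sup>+\<omega>. ennreal ((norm (Y \<omega>))\<^sup>2) \<partial>M) = (\<integral>\<^sup>+\<omega>. liminf (\<lambda>k. ?s k \<omega>) \<partial>M)" by simp
  also have "\<dots> \<le> liminf (\<lambda>k. \<integral>\<^sup>+\<omega>. ?s k \<omega> \<partial>M)"
    by (rule nn_integral_liminf) (intro borel_measurable_sum meas)
  also have "\<dots> \<le> liminf (\<lambda>k::nat. B)"
  proof (intro Liminf_mono always_eventually allI)
    fix k
    show "(\<integral>\<^sup>+\<omega>. ?s k \<omega> \<partial>M) \<le> B"
      using le[OF F(1,2), of k] by (simp add: nn_integral_sum meas del: sum_ennreal)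
  qed
  also have "\<dots> = B" by (simp add: Liminf_const)
  finally show ?thesis .
qed

context tikhonov_gain
begin

text \<open>White noise is no element of \<open>Y\<close>, so the error formula is tested against
  vectors, with a null set depending on \<open>x\<close>. The induction is over all
  \<open>x\<close>, as one step replaces \<open>x\<close> by \<open>H x\<close>.\<close>

lemma iterates_error_inner:
  assumes wn: "white_noise M \<gamma> \<eta>"
    and it: "iterates_3dvar M A S \<alpha> z0 (data_model2 A u \<eta>) \<zeta>"
  shows "AE \<omega> in M. (\<zeta> n \<omega> - u) \<bullet> x = (G ^^ n) (z0 - u) \<bullet> x + \<eta> (Fadj n x) \<omega>"
proof (induction n arbitrary: x)
  case 0
  have "\<zeta> 0 \<omega> = z0" for \<omega> using it by (simp add: iterates_3dvar_def)
  then show ?case using white_noise_zero[OF wn] by (simp add: Fadj_def)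
next
  case (Suc n)
  define r where "r = R (A (S x))"
  have "\<exists>\<xi>. op_image_of M (gain A S \<alpha>) (\<lambda>h \<omega>. data_model2 A u \<eta> (Suc n) h \<omega> - A (\<zeta> n \<omega>) \<bullet> h) \<xi> \<and>
      (\<forall>\<omega>. \<zeta> (Suc n) \<omega> = \<zeta> n \<omega> + \<xi> \<omega>)"
  proof -
    from it have "\<forall>n\<ge>1. \<zeta> n \<in> borel_measurable M \<and> (\<exists>\<xi>. op_image_of M (gain A S \<alpha>)
        (\<lambda>h \<omega>. data_model2 A u \<eta> n h \<omega> - A (\<zeta> (n - 1) \<omega>) \<bullet> h) \<xi> \<and> (\<forall>\<omega>. \<zeta> n \<omega> = \<zeta> (n - 1) \<omega> + \<xi> \<omega>))"
      unfolding iterates_3dvar_def by (rule conjunct2)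
    from spec[OF this, of "Suc n"] show ?thesis by simp
  qed
  then obtain \<xi> where \<xi>: "op_image_of M (gain A S \<alpha>) (\<lambda>h \<omega>. data_model2 A u \<eta> (Suc n) h \<omega> - A (\<zeta> n \<omega>) \<bullet> h) \<xi>"
    and step: "\<And>\<omega>. \<zeta> (Suc n) \<omega> = \<zeta> n \<omega> + \<xi> \<omega>" by auto
  have "AE \<omega> in M. \<xi> \<omega> \<bullet> x = A u \<bullet> r + \<eta> r \<omega> - A (\<zeta> n \<omega>) \<bullet> r"
    using \<xi> by (simp add: op_image_of_def adjoint_gain data_model2_def r_def)
  moreover have "AE \<omega> in M. \<eta> (Fadj n (H x) + r) \<omega> = \<eta> (Fadj n (H x)) \<omega> + \<eta> r \<omega>"
    by (rule white_noise_add[OF wn])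
  ultimately show ?case using Suc.IH[of "H x"]
  proof eventually_elim
    case (elim \<omega>)
    have "(\<zeta> (Suc n) \<omega> - u) \<bullet> x = (\<zeta> n \<omega> - u) \<bullet> x - A (\<zeta> n \<omega> - u) \<bullet> r + \<eta> r \<omega>"
      using elim(1) by (simp add: step inner_diff_left inner_add_left A_simps)
    also have "(\<zeta> n \<omega> - u) \<bullet> x - A (\<zeta> n \<omega> - u) \<bullet> r = (\<zeta> n \<omega> - u) \<bullet> H x"
      by (simp add: inner_A H_def r_def inner_diff_right)
    also have "\<dots> = (G ^^ n) (z0 - u) \<bullet> H x + \<eta> (Fadj n (H x)) \<omega>" by (rule elim(3))
    also have "(G ^^ n) (z0 - u) \<bullet> H x = (G ^^ Suc n) (z0 - u) \<bullet> x" by (simp add: inner_G)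
    finally show ?case using elim(2) by (simp add: Fadj_Suc r_def)
  qed
qed

text \<open>Each coordinate has an exact second moment, and \<open>norm_Fadj\<close> turns the noise
  part into a diagonal entry of \<open>S\<close>. Integrability is recorded because the expectation
  of a nonintegrable function is 0 by convention.\<close>

lemma mean_square_error:
  assumes M: "prob_space M" and \<gamma>: "0 < \<gamma>" and wn: "white_noise M \<gamma> \<eta>"
    and it: "iterates_3dvar M A S \<alpha> z0 (data_model2 A u \<eta>) \<zeta>" and n: "1 \<le> n"
  shows "integrable M (\<lambda>\<omega>. (norm (\<zeta> n \<omega> - u))\<^sup>2)" (is ?int)
    and "prob_space.expectation M (\<lambda>\<omega>. (norm (\<zeta> n \<omega> - u))\<^sup>2)
      \<le> (norm ((G ^^ n) (z0 - u)))\<^sup>2 + real n * \<gamma>\<^sup>2 / \<alpha> * trace_pos S" (is ?le)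
proof -
  interpret prob_space M by fact
  define E where "E = (SOME E :: 'x set. orthonormal_basis E)"
  have E: "orthonormal_basis E"
    unfolding E_def by (rule someI_ex) (use trace_class in \<open>auto simp: trace_class_pos_def\<close>)
  have tr: "trace_pos S = (\<Sum>\<^sub>\<infinity>e\<in>E. S e \<bullet> e)" by (simp add: trace_pos_def E_def)
  have "0 \<le> trace_pos S" unfolding tr by (rule infsum_nonneg) (rule pos_S)
  let ?e = "(G ^^ n) (z0 - u)"
  let ?B = "(norm ?e)\<^sup>2 + real n * \<gamma>\<^sup>2 / \<alpha> * trace_pos S"
  have B: "0 \<le> ?B" using \<open>0 \<le> trace_pos S\<close> \<alpha>_pos by simp
  have \<zeta>: "\<zeta> n \<in> borel_measurable M" using it n by (simp add: iterates_3dvar_def)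
  have Y: "(\<lambda>\<omega>. \<zeta> n \<omega> - u) \<in> borel_measurable M"
  proof -
    have "(\<lambda>z. z - u) \<in> borel_measurable borel"
      by (intro borel_measurable_continuous_onI continuous_intros)
    from measurable_compose[OF \<zeta> this] show ?thesis .
  qed
  have nn: "(\<integral>\<^sup>+\<omega>. ennreal ((norm (\<zeta> n \<omega> - u))\<^sup>2) \<partial>M) \<le> ennreal ?B"
  proof (rule nn_integral_norm_sq_le[OF E countable_orthonormal_basis[OF E] Y])
    fix F assume F: "finite F" "F \<subseteq> E"
    have "(\<integral>\<^sup>+\<omega>. ennreal (((\<zeta> n \<omega> - u) \<bullet> x)\<^sup>2) \<partial>M) = ennreal ((?e \<bullet> x)\<^sup>2 + \<gamma>\<^sup>2 * (norm (Fadj n x))\<^sup>2)" for x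
      unfolding white_noise_second_moment[OF M \<gamma> wn, symmetric]
      by (rule nn_integral_cong_AE) (use iterates_error_inner[OF wn it, of n x] in auto)
    then have "(\<Sum>x\<in>F. \<integral>\<^sup>+\<omega>. ennreal (((\<zeta> n \<omega> - u) \<bullet> x)\<^sup>2) \<partial>M)
        = ennreal (\<Sum>x\<in>F. (?e \<bullet> x)\<^sup>2 + \<gamma>\<^sup>2 * (norm (Fadj n x))\<^sup>2)"
      by (simp del: ennreal_plus)
    also have "\<dots> \<le> ennreal ?B"
    proof (rule ennreal_leI)
      have "(\<Sum>x\<in>F. (?e \<bullet> x)\<^sup>2 + \<gamma>\<^sup>2 * (norm (Fadj n x))\<^sup>2)
          \<le> (\<Sum>x\<in>F. (?e \<bullet> x)\<^sup>2 + \<gamma>\<^sup>2 * (real n / \<alpha> * (S x \<bullet> x)))"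
        by (intro sum_mono add_left_mono mult_left_mono norm_Fadj) simp
      also have "\<dots> = (\<Sum>x\<in>F. (?e \<bullet> x)\<^sup>2) + real n * \<gamma>\<^sup>2 / \<alpha> * (\<Sum>x\<in>F. S x \<bullet> x)"
        by (simp add: sum.distrib sum_distrib_left sum_divide_distrib mult_ac)
      also have "\<dots> \<le> ?B"
      proof (intro add_mono mult_left_mono)
        show "(\<Sum>x\<in>F. (?e \<bullet> x)\<^sup>2) \<le> (norm ?e)\<^sup>2"
          by (rule finite_sum_le_has_sum[OF orthonormal_basis_Parseval[OF E] F]) simp
        show "(\<Sum>x\<in>F. S x \<bullet> x) \<le> trace_pos S"
          unfolding tr by (rule finite_sum_le_infsum[OF trace_summable[OF E] F]) (rule pos_S)
      qed (use \<alpha>_pos in simp)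
      finally show "(\<Sum>x\<in>F. (?e \<bullet> x)\<^sup>2 + \<gamma>\<^sup>2 * (norm (Fadj n x))\<^sup>2) \<le> ?B" .
    qed
    finally show "(\<Sum>x\<in>F. \<integral>\<^sup>+\<omega>. ennreal (((\<zeta> n \<omega> - u) \<bullet> x)\<^sup>2) \<partial>M) \<le> ennreal ?B" .
  qed
  have meas: "(\<lambda>\<omega>. (norm (\<zeta> n \<omega> - u))\<^sup>2) \<in> borel_measurable M"
  proof -
    have "(\<lambda>y::'x. (norm y)\<^sup>2) \<in> borel_measurable borel"
      by (intro borel_measurable_continuous_onI continuous_intros)
    from measurable_compose[OF Y this] show ?thesis .
  qed
  show ?int
  proof (rule integrableI_bounded[OF meas])
    show "(\<integral>\<^sup>+\<omega>. ennreal (norm ((norm (\<zeta> n \<omega> - u))\<^sup>2)) \<partial>M) < \<infinity>"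
      using nn by (simp add: le_less_trans)
  qed
  have "expectation (\<lambda>\<omega>. (norm (\<zeta> n \<omega> - u))\<^sup>2) = enn2real (\<integral>\<^sup>+\<omega>. ennreal ((norm (\<zeta> n \<omega> - u))\<^sup>2) \<partial>M)"
    by (rule integral_eq_nn_integral) (use meas in auto)
  also have "\<dots> \<le> enn2real (ennreal ?B)" by (rule enn2real_mono[OF nn]) simp
  also have "\<dots> = ?B" using B by simp
  finally show ?le .
qed

end

theorem theorem7:
  fixes A :: "'x::{real_inner,complete_space} \<Rightarrow> 'y::{real_inner,complete_space}"
    and S :: "'x \<Rightarrow> 'x" and u z0 :: 'x and a c s :: real
  assumes "compact_operator A"
    and "assumption_A A S u z0 a c s"
  shows "\<exists>C::real.
    (\<forall>\<alpha> \<gamma> (M::'w measure) \<eta> \<zeta>.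
       0 < \<alpha> \<and> 0 < \<gamma> \<and> prob_space M \<and> white_noise M \<gamma> \<eta> \<and>
       iterates_3dvar M A S \<alpha> z0 (data_model2 A u \<eta>) \<zeta> \<longrightarrow>
       (\<forall>n\<ge>1. integrable M (\<lambda>\<omega>. (norm (\<zeta> n \<omega> - u))\<^sup>2) \<and>
          prob_space.expectation M (\<lambda>\<omega>. (norm (\<zeta> n \<omega> - u))\<^sup>2)
            \<le> C * (\<alpha> / real n) powr (s / (a + 1)) + real n * \<gamma>\<^sup>2 / \<alpha> * trace_pos S)) \<and>
    (\<forall>N \<gamma> (M::'w measure) \<eta> \<zeta>.
       1 \<le> N \<and> 0 < \<gamma> \<and> \<gamma>\<^sup>2 = real N powr (- ((a + s + 1) / (a + 1))) \<and>
       prob_space M \<and> white_noise M \<gamma> \<eta> \<and>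
       iterates_3dvar M A S 1 z0 (data_model2 A u \<eta>) \<zeta> \<longrightarrow>
       integrable M (\<lambda>\<omega>. (norm (\<zeta> N \<omega> - u))\<^sup>2) \<and>
       prob_space.expectation M (\<lambda>\<omega>. (norm (\<zeta> N \<omega> - u))\<^sup>2)
         \<le> (C + trace_pos S) * real N powr (- (s / (a + 1))))"
proof -
  have bA: "bounded_linear A" using assms(1) by (simp add: compact_operator_def)
  have tc: "trace_class_pos S" and a: "0 < a" and c: "1 \<le> c" and s: "0 \<le> s" "s \<le> a + 2"
    and dom: "z0 - u \<in> op_powr_dom S (- s/2)" and sv: "single_valued (inverse_graph S)"
    and "\<forall>x. inverse c * norm (op_powr S (a/2) x) \<le> norm (A x) \<and>
      norm (A x) \<le> c * norm (op_powr S (a/2) x)"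
    using assms(2) unfolding assumption_A_def densely_defined_self_adjoint_def
    by blast+
  then have link: "inverse c * norm (op_powr S (a/2) x) \<le> norm (A x)"
      "norm (A x) \<le> c * norm (op_powr S (a/2) x)" for x by simp_all
  \<comment> \<open>Injectivity is the single-valuedness of the inverse graph at 0.\<close>
  interpret S: injective_trace_class S
  proof
    fix x assume "S x = 0"
    moreover have "S 0 = 0"
      using tc by (auto simp: trace_class_pos_def positive_self_adjoint_def linear_simps)
    ultimately have "(0, x) \<in> inverse_graph S" "(0, 0) \<in> inverse_graph S"
      unfolding inverse_graph_def by (metis (mono_tags, lifting) mem_Collect_eq)+
    then show "x = 0" using sv by (auto simp: single_valued_def)
  qed (rule tc)
  define w where "w = S.mult (\<lambda>l. l powr (- s/2)) (z0 - u)"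
  have Pw: "S.P l w = l powr (- s/2) *\<^sub>R S.P l (z0 - u)" if "0 < l" for l
    unfolding w_def
  proof (rule S.p_mult)
    have "(l powr (- s/2))\<^sup>2 = l powr (2 * (- s/2))" for l by (subst powr_half_sq) simp
    then show "(\<lambda>l. (l powr (- s/2))\<^sup>2 * (norm (S.P l (z0 - u)))\<^sup>2) summable_on {0<..}"
      using dom by (simp only: op_powr_dom_def mem_Collect_eq)
  qed (use that in simp)
  have e0: "S.P l (z0 - u) = l powr (s/2) *\<^sub>R S.P l w" if "0 < l" for l
    using that by (simp add: Pw flip: powr_add)
  have filter: "smoothing_filter S A \<alpha> a c" if "0 < \<alpha>" for \<alpha>
  proof (intro smoothing_filter.intro smoothing_filter_axioms.intro
      tikhonov_gain.intro tikhonov_gain_axioms.intro)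
    show "norm (op_powr S (a/2) x) \<le> c * norm (A x)" for x
      using link(1)[of x] c by (simp add: field_simps)
  qed (use that bA a c link(2) S.injective_trace_class_axioms in auto)
  \<comment> \<open>Fixed before \<alpha> and \<gamma> enter: \<open>C0\<close> depends on a and c
    only, and \<open>w\<close> on the initial error.\<close>
  define C where "C = 2 * (smoothing_filter.C0 a c + c\<^sup>2 + c ^ 4) * (norm w)\<^sup>2"
  have main: "integrable M (\<lambda>\<omega>. (norm (\<zeta> n \<omega> - u))\<^sup>2) \<and>
      prob_space.expectation M (\<lambda>\<omega>. (norm (\<zeta> n \<omega> - u))\<^sup>2)
        \<le> C * (\<alpha> / real n) powr (s / (a + 1)) + real n * \<gamma>\<^sup>2 / \<alpha> * trace_pos S"
    if "0 < \<alpha>" "0 < \<gamma>" "prob_space M" "white_noise M \<gamma> \<eta>"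
      "iterates_3dvar M A S \<alpha> z0 (data_model2 A u \<eta>) \<zeta>" "1 \<le> n"
    for \<alpha> \<gamma> and M :: "'w measure" and \<eta> \<zeta> n
  proof -
    interpret smoothing_filter S A \<alpha> a c by (rule filter[OF that(1)])
    have "(norm ((G ^^ n) (z0 - u)))\<^sup>2 \<le> C * (\<alpha> / real n) powr (s / (a + 1))"
      unfolding C_def by (rule bias_bound[OF _ s e0]) (use that(6) in auto)
    then show ?thesis using mean_square_error[OF that(3,2,4-6)] by (meson add_right_mono order_trans)
  qed
  show ?thesis
  proof (intro exI[of _ C] conjI allI impI; elim conjE)
    fix N :: nat and \<gamma> and M :: "'w measure" and \<eta> \<zeta>
    assume N: "1 \<le> N" and \<gamma>: "\<gamma>\<^sup>2 = real N powr (- ((a + s + 1) / (a + 1)))"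
      and rest: "0 < \<gamma>" "prob_space M" "white_noise M \<gamma> \<eta>"
      "iterates_3dvar M A S 1 z0 (data_model2 A u \<eta>) \<zeta>"
    have bias: "(1 / real N) powr (s / (a + 1)) = real N powr (- (s / (a + 1)))"
      using N by (simp add: powr_divide powr_minus_divide)
    \<comment> \<open>The prescribed noise level makes the variance factor decay at exactly the rate
      of the bias.\<close>
    have "real N * \<gamma>\<^sup>2 = real N powr (1 + - ((a + s + 1) / (a + 1)))"
      using N by (simp only: \<gamma> powr_add) simp
    also have "1 + - ((a + s + 1) / (a + 1)) = - (s / (a + 1))" using a by (simp add: field_simps)
    finally have noise: "real N * \<gamma>\<^sup>2 = real N powr (- (s / (a + 1)))" .
    note m = main[OF zero_less_one rest N]
    show "integrable M (\<lambda>\<omega>. (norm (\<zeta> N \<omega> - u))\<^sup>2)" using m by blast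
    show "prob_space.expectation M (\<lambda>\<omega>. (norm (\<zeta> N \<omega> - u))\<^sup>2)
        \<le> (C + trace_pos S) * real N powr (- (s / (a + 1)))"
      using m unfolding bias div_by_1 noise by (simp add: distrib_right mult.commute)
  qed (use main in blast)+
qed

end
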